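(* Let $k,l\geq 2$ be integers. Then \[ \mathrm{ex}(n,C_{2l+1},\textnormal{rainbow-}C_{2k})= \begin{cases} \Theta(n^{l}) & \text{if } k\geq 3,\\ \Theta(n^{l+1/2}) & \text{if } k=2. \end{cases} \]
   Context: A proper edge-colouring of a graph assigns colours to edges so that any two edges sharing a vertex receive different colours. A subgraph of an edge-coloured graph is rainbow if all its edges have distinct colours. $\mathrm{ex}(n,H,\textnormal{rainbow-}F)$ denotes the maximum number of copies of $H$ in a properly edge-coloured graph on $n$ vertices containing no rainbow subgraph isomorphic to $F$. $C_m$ denotes the cycle of length $m$. Implied constants may depend on $k$ and $l$. *)

theory Defs
  imports Complex_Main "HOL-Library.Landau_Symbols"
begin

type_synonym 'a ugraph = "'a set \<times> 'a set set"

abbreviation verts :: "'a ugraph \<Rightarrow> 'a set" where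
  "verts G \<equiv> fst G"

abbreviation edges :: "'a ugraph \<Rightarrow> 'a set set" where
  "edges G \<equiv> snd G"

definition simple_graph :: "'a ugraph \<Rightarrow> bool" where
  "simple_graph G \<longleftrightarrow> finite (verts G) \<and> (\<forall>e\<in>edges G. e \<subseteq> verts G \<and> card e = 2)"

definition subgraph :: "'a ugraph \<Rightarrow> 'a ugraph \<Rightarrow> bool" where
  "subgraph S G \<longleftrightarrow> simple_graph S \<and> verts S \<subseteq> verts G \<and> edges S \<subseteq> edges G"

definition graph_iso :: "'a ugraph \<Rightarrow> 'b ugraph \<Rightarrow> bool" where
  "graph_iso G H \<longleftrightarrow> (\<exists>f. bij_betw f (verts G) (verts H) \<and> edges H = (\<lambda>e. f ` e) ` edges G)"

text \<open>Copies are subgraphs, not embeddings: an isomorphic subgraph is counted once,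
  irrespective of its automorphisms. They need not be induced.\<close>

definition copies :: "'b ugraph \<Rightarrow> 'a ugraph \<Rightarrow> 'a ugraph set" where
  "copies H G = {S. subgraph S G \<and> graph_iso H S}"

definition proper_edge_colouring :: "'a ugraph \<Rightarrow> ('a set \<Rightarrow> 'c) \<Rightarrow> bool" where
  "proper_edge_colouring G c \<longleftrightarrow>
     (\<forall>e\<in>edges G. \<forall>e'\<in>edges G. e \<noteq> e' \<and> e \<inter> e' \<noteq> {} \<longrightarrow> c e \<noteq> c e')"

definition rainbow :: "('a set \<Rightarrow> 'c) \<Rightarrow> 'a ugraph \<Rightarrow> bool" where
  "rainbow c S \<longleftrightarrow> inj_on c (edges S)"

definition rainbow_free :: "'b ugraph \<Rightarrow> 'a ugraph \<Rightarrow> ('a set \<Rightarrow> 'c) \<Rightarrow> bool" where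
  "rainbow_free F G c \<longleftrightarrow> \<not> (\<exists>S\<in>copies F G. rainbow c S)"

text \<open>Taking vertices and colours in \<^typ>\<open>nat\<close> is no restriction, since the graphs are finite.
  The number of colours is not bounded.\<close>

definition rainbow_copy_counts :: "nat \<Rightarrow> 'a ugraph \<Rightarrow> 'b ugraph \<Rightarrow> nat set" where
  "rainbow_copy_counts n H F =
     {card (copies H G) | (G :: nat ugraph) (c :: nat set \<Rightarrow> nat).
        simple_graph G \<and> card (verts G) = n \<and> proper_edge_colouring G c \<and> rainbow_free F G c}"

definition ex_rainbow :: "nat \<Rightarrow> 'a ugraph \<Rightarrow> 'b ugraph \<Rightarrow> nat" where
  "ex_rainbow n H F = Max (rainbow_copy_counts n H F)"

text \<open>This is a cycle of length \<open>m\<close> only for \<open>m \<ge> 3\<close>.\<close>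

definition cycle_graph :: "nat \<Rightarrow> nat ugraph" where
  "cycle_graph m = ({..<m}, {{i, Suc i mod m} | i. i < m})"

text \<open>The maximum in \<^const>\<open>ex_rainbow\<close> is over a finite set, which is nonempty
  as soon as the forbidden graph has an edge.\<close>

lemma finite_rainbow_copy_counts: "finite (rainbow_copy_counts n H F)"
proof -
  have "card (copies H G) \<le> 2 ^ n * 2 ^ (2 ^ n)"
    if "simple_graph G" "card (verts G) = n" for G :: "nat ugraph"
  proof -
    have fin: "finite (verts G)"
      using that by (simp add: simple_graph_def)
    have "copies H G \<subseteq> Pow (verts G) \<times> Pow (Pow (verts G))"
      unfolding copies_def subgraph_def simple_graph_def by fastforce
    then have "card (copies H G) \<le> card (Pow (verts G) \<times> Pow (Pow (verts G)))"
      using fin by (intro card_mono) auto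
    also have "\<dots> = 2 ^ n * 2 ^ (2 ^ n)"
      using fin that by (simp add: card_cartesian_product card_Pow)
    finally show ?thesis .
  qed
  then have "rainbow_copy_counts n H F \<subseteq> {..2 ^ n * 2 ^ (2 ^ n)}"
    unfolding rainbow_copy_counts_def by auto
  then show ?thesis
    using finite_subset by blast
qed

lemma rainbow_copy_counts_nonempty:
  assumes "edges F \<noteq> {}"
  shows "rainbow_copy_counts n H F \<noteq> {}"
proof -
  let ?G = "({..<n}, {}) :: nat ugraph"
  have "rainbow_free F ?G c" for c :: "nat set \<Rightarrow> nat"
    using assms unfolding rainbow_free_def copies_def subgraph_def graph_iso_def by auto
  then have "card (copies H ?G) \<in> rainbow_copy_counts n H F"
    unfolding rainbow_copy_counts_def simple_graph_def proper_edge_colouring_def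
    by (intro CollectI exI[of _ ?G] exI[of _ "\<lambda>_. 0"]) auto
  then show ?thesis by blast
qed

end

theory Submission
  imports Defs "HOL-Analysis.Convex" "HOL-Algebra.Algebraic_Closure_Type" "HOL-Library.Z2"
begin

text \<open>
  Upper bound. If the bipartite graph between the neighbourhood of a vertex \<open>u\<close> and a set \<open>Y\<close> had a
  large constant times \<open>deg u + card Y\<close> edges, a greedy rainbow path in a subgraph of large minimum degree
  would close through \<open>u\<close> to a rainbow \<open>C_2k\<close>. Hence only \<open>O(n)\<close> walks of length two start at \<open>u\<close>,
  and only \<open>O(deg u)\<close> of them end in a vertex with which \<open>u\<close> has many common neighbours.
  So the number of \<open>(2l + 1)\<close>-cycles is at most a constant times the number of walks with
  \<open>2l - 1\<close> edges: the vertex between the two ends of such a walk has boundedly many choices if the ends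
  have few common neighbours, and the other case is covered by the \<open>O(deg u)\<close> bound. This gives
  \<open>O(n^(l - 1) e(G))\<close> with \<open>e(G) = O(n^(3/2))\<close>, which suffices for \<open>k = 2\<close>.

  For \<open>k \<ge> 3\<close> it remains to show that there are \<open>Q = O(n^2)\<close> walks \<open>u p b m\<close> of length three.
  Fix \<open>u\<close>. Unless, up to \<open>O(n)\<close> exceptions, the colour of \<open>p b\<close> is determined by \<open>u\<close> and \<open>m\<close>, a
  rainbow path between two vertices \<open>m\<close> and \<open>m'\<close> extends at both ends to a rainbow \<open>C_2k\<close> through \<open>u\<close>.
  By Cauchy-Schwarz the number \<open>R\<close> of walks with determined middle colour satisfies
  \<open>R^2 \<le> n^2 N\<close>, where \<open>N\<close> counts pairs of walks with common ends and equal middle colours;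
  since one middle edge and one end of the other determine the other, \<open>N = O(Q)\<close>.
  Thus \<open>Q = O(n^2 + n Q^(1/2))\<close>.

  Lower bound. For \<open>k \<ge> 3\<close> replace every second vertex of a \<open>(2l + 1)\<close>-cycle by many copies.
  For \<open>k = 2\<close> take the \<open>C_4\<close>-free graph on \<open>K \<times> K\<close>, \<open>K = GF(2^m)\<close>, in which \<open>(x, y)\<close> and
  \<open>(x', y')\<close> are adjacent iff \<open>y y' = x + x'\<close>.
\<close>

subsection \<open>Counting lemmas\<close>

lemma card_le_fibres:
  assumes "finite A" "finite B" "f ` A \<subseteq> B" "\<And>y. y \<in> B \<Longrightarrow> card {x \<in> A. f x = y} \<le> c"
  shows "card A \<le> c * card B"
proof -
  have "card A = (\<Sum>x\<in>A. 1)" by simp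
  also have "\<dots> = (\<Sum>y\<in>B. \<Sum>x\<in>{x \<in> A. f x = y}. 1)"
    using assms by (intro sum.group[symmetric]) auto
  also have "\<dots> = (\<Sum>y\<in>B. card {x \<in> A. f x = y})" by simp
  also have "\<dots> \<le> (\<Sum>y\<in>B. c)" by (intro sum_mono) (use assms in auto)
  finally show ?thesis by (simp add: mult.commute)
qed

lemma card_fibres_bound:
  assumes "finite U" "finite S" "\<And>v. v \<in> S \<Longrightarrow> card {x \<in> U. f x = v} \<le> c" "card S \<le> s"
  shows "card {x \<in> U. f x \<in> S} \<le> c * s"
proof -
  have "card {x \<in> U. f x \<in> S} \<le> c * card S"
  proof (rule card_le_fibres[where f = f])
    fix y assume "y \<in> S"
    have "card {x \<in> {x \<in> U. f x \<in> S}. f x = y} \<le> card {x \<in> U. f x = y}"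
      using assms(1) by (intro card_mono) auto
    then show "card {x \<in> {x \<in> U. f x \<in> S}. f x = y} \<le> c"
      using assms(3)[OF \<open>y \<in> S\<close>] by linarith
  qed (use assms in auto)
  also have "\<dots> \<le> c * s" using assms(4) by simp
  finally show ?thesis .
qed

text \<open>Delete vertices of degree below \<open>D\<close> one after another: each deletion costs
  fewer than \<open>D\<close> edges, and the edges that survive have both ends of degree at least
  \<open>D\<close>.\<close>

lemma min_degree_core:
  assumes "finite A" "finite B" "F \<subseteq> A \<times> B"
  obtains F' where "F' \<subseteq> F" "card F \<le> card F' + D * (card A + card B)"
    "\<And>x m. (x, m) \<in> F' \<Longrightarrow> D \<le> card {m'. (x, m') \<in> F'} \<and> D \<le> card {x'. (x', m) \<in> F'}"
proof -
  have "\<exists>F'\<subseteq>F. card F \<le> card F' + D * (card A + card B) \<and>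
    (\<forall>x m. (x, m) \<in> F' \<longrightarrow> D \<le> card {m'. (x, m') \<in> F'} \<and> D \<le> card {x'. (x', m) \<in> F'})"
    using assms
  proof (induction "card A + card B" arbitrary: A B F rule: less_induct)
    case less
    have finF: "finite F" using less.prems by (meson finite_SigmaI finite_subset)
    consider (core) "\<forall>x m. (x, m) \<in> F \<longrightarrow> D \<le> card {m'. (x, m') \<in> F} \<and> D \<le> card {x'. (x', m) \<in> F}"
      | (left) x m where "(x, m) \<in> F" "card {m'. (x, m') \<in> F} < D"
      | (right) x m where "(x, m) \<in> F" "card {x'. (x', m) \<in> F} < D"
      by (meson not_le)
    then show ?case
    proof cases
      case core
      then show ?thesis by (intro exI[of _ F]) auto
    next
      case left
      let ?L = "{e \<in> F. fst e = x}" and ?R = "{e \<in> F. fst e \<noteq> x}"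
      have xA: "x \<in> A" using left less.prems by auto
      have cA: "card (A - {x}) + 1 = card A"
        using xA less.prems(1) by (metis Suc_eq_plus1 card_Suc_Diff1)
      have "\<exists>F'\<subseteq>?R. card ?R \<le> card F' + D * (card (A - {x}) + card B) \<and>
        (\<forall>x m. (x, m) \<in> F' \<longrightarrow> D \<le> card {m'. (x, m') \<in> F'} \<and> D \<le> card {x'. (x', m) \<in> F'})"
        by (rule less.hyps) (use cA less.prems in auto)
      then obtain F' where F': "F' \<subseteq> ?R" "card ?R \<le> card F' + D * (card (A - {x}) + card B)"
        "\<forall>x m. (x, m) \<in> F' \<longrightarrow> D \<le> card {m'. (x, m') \<in> F'} \<and> D \<le> card {x'. (x', m) \<in> F'}"
        by blast
      have "?L = Pair x ` {m'. (x, m') \<in> F}" by auto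
      then have "card ?L = card {m'. (x, m') \<in> F}" by (simp add: card_image inj_on_def)
      then have "card ?L \<le> D" using left by linarith
      moreover have "card F = card ?L + card ?R"
        using finF by (subst card_Un_disjoint[symmetric]) (auto intro!: arg_cong[where f = card])
      ultimately have "card F \<le> card F' + (D * (card (A - {x}) + card B) + D)"
        using F'(2) by linarith
      also have "D * (card (A - {x}) + card B) + D = D * (card A + card B)"
        unfolding cA[symmetric] by (simp add: algebra_simps)
      finally show ?thesis using F' by (intro exI[of _ F']) auto
    next
      case right
      let ?L = "{e \<in> F. snd e = m}" and ?R = "{e \<in> F. snd e \<noteq> m}"
      have mB: "m \<in> B" using right less.prems by auto
      have cB: "card (B - {m}) + 1 = card B"
        using mB less.prems(2) by (metis Suc_eq_plus1 card_Suc_Diff1)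
      have "\<exists>F'\<subseteq>?R. card ?R \<le> card F' + D * (card A + card (B - {m})) \<and>
        (\<forall>x m. (x, m) \<in> F' \<longrightarrow> D \<le> card {m'. (x, m') \<in> F'} \<and> D \<le> card {x'. (x', m) \<in> F'})"
        by (rule less.hyps) (use cB less.prems in auto)
      then obtain F' where F': "F' \<subseteq> ?R" "card ?R \<le> card F' + D * (card A + card (B - {m}))"
        "\<forall>x m. (x, m) \<in> F' \<longrightarrow> D \<le> card {m'. (x, m') \<in> F'} \<and> D \<le> card {x'. (x', m) \<in> F'}"
        by blast
      have "?L = (\<lambda>x. (x, m)) ` {x'. (x', m) \<in> F}" by auto
      then have "card ?L = card {x'. (x', m) \<in> F}" by (simp add: card_image inj_on_def)
      then have "card ?L \<le> D" using right by linarith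
      moreover have "card F = card ?L + card ?R"
        using finF by (subst card_Un_disjoint[symmetric]) (auto intro!: arg_cong[where f = card])
      ultimately have "card F \<le> card F' + (D * (card A + card (B - {m})) + D)"
        using F'(2) by linarith
      also have "D * (card A + card (B - {m})) + D = D * (card A + card B)"
        unfolding cB[symmetric] by (simp add: algebra_simps)
      finally show ?thesis using F' by (intro exI[of _ F']) auto
    qed
  qed
  then show ?thesis using that by blast
qed

text \<open>A uniformly random set \<open>S\<close> of colours satisfies the three conditions at a given \<open>w\<close>
  with probability at least 1/8.\<close>

lemma colour_split:
  assumes "finite W" "\<And>w. w \<in> W \<Longrightarrow> g w \<noteq> f w" "\<And>w. w \<in> W \<Longrightarrow> g w \<noteq> h w"
  obtains S where "card W \<le> 8 * card {w \<in> W. g w \<in> S \<and> f w \<notin> S \<and> h w \<notin> S}"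
proof -
  define C where "C = f ` W \<union> g ` W \<union> h ` W"
  have fC: "finite C" using assms by (simp add: C_def)
  let ?P = "\<lambda>w S. g w \<in> S \<and> f w \<notin> S \<and> h w \<notin> S"
  have one: "2 ^ card C \<le> 8 * card {S \<in> Pow C. ?P w S}" if w: "w \<in> W" for w
  proof -
    let ?T = "{f w, g w, h w}"
    have sub: "?T \<subseteq> C" using w by (auto simp: C_def)
    have "card ?T \<le> 3" by (simp add: card_insert_if)
    have "card C = card (C - ?T) + card ?T"
      using sub fC by (metis card_Diff_subset card_mono finite_subset le_add_diff_inverse2)
    then have "card C \<le> card (C - ?T) + 3" using \<open>card ?T \<le> 3\<close> by linarith
    then have "(2::nat) ^ card C \<le> 2 ^ (card (C - ?T) + 3)" by (intro power_increasing) auto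
    also have "\<dots> = 8 * card (Pow (C - ?T))" using fC by (simp add: card_Pow power_add)
    \<comment> \<open>A set avoiding \<open>?T\<close>, enlarged by \<open>g w\<close>, satisfies
      the three conditions at \<open>w\<close>. At most three memberships are prescribed, hence the
      factor 8.\<close>
    also have "card (Pow (C - ?T)) = card (insert (g w) ` Pow (C - ?T))"
      by (intro card_image[symmetric] inj_onI) blast
    also have "\<dots> \<le> card {S \<in> Pow C. ?P w S}"
      using fC sub assms(2,3)[OF w] by (intro card_mono) auto
    finally show ?thesis by simp
  qed
  have "card W * 2 ^ card C = (\<Sum>w\<in>W. 2 ^ card C)" by simp
  also have "\<dots> \<le> (\<Sum>w\<in>W. 8 * card {S \<in> Pow C. ?P w S})" by (intro sum_mono one)
  also have "\<dots> = 8 * (\<Sum>w\<in>W. \<Sum>S\<in>{S \<in> Pow C. ?P w S}. 1)" by (simp add: sum_distrib_left)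
  also have "(\<Sum>w\<in>W. \<Sum>S\<in>{S \<in> Pow C. ?P w S}. 1) = (\<Sum>S\<in>Pow C. \<Sum>w\<in>{w \<in> W. ?P w S}. (1::nat))"
    using assms(1) fC by (intro sum.swap_restrict) auto
  finally have le: "card W * 2 ^ card C \<le> 8 * (\<Sum>S\<in>Pow C. card {w \<in> W. ?P w S})" by simp
  \<comment> \<open>Averaging: if every \<open>S\<close> fell short, summing over
    \<open>Pow C\<close> would contradict \<open>le\<close>.\<close>
  show ?thesis
  proof (rule ccontr)
    assume "\<not> thesis"
    then have lt: "8 * card {w \<in> W. ?P w S} < card W" for S using that by (meson not_le)
    have "(\<Sum>S\<in>Pow C. 8 * card {w \<in> W. ?P w S}) < (\<Sum>S\<in>Pow C. card W)"
      using fC lt by (intro sum_strict_mono) auto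
    then show False using le fC by (simp add: card_Pow sum_distrib_left mult.commute)
  qed
qed

text \<open>Cauchy-Schwarz for the sizes of the fibres of \<open>f\<close>, whose squares count the
  pairs.\<close>

lemma card_power2_le_pairs:
  assumes "finite A" "finite B" "f ` A \<subseteq> B"
  shows "(card A)\<^sup>2 \<le> card B * card {(x, y) \<in> A \<times> A. f x = f y}"
proof -
  let ?r = "\<lambda>b. card {x \<in> A. f x = b}"
  have cA: "card A = sum ?r B"
    using sum.group[OF assms, of "\<lambda>_. 1::nat"] by simp
  have "{(x, y) \<in> A \<times> A. f x = f y} = (\<Union>b\<in>B. {x \<in> A. f x = b} \<times> {x \<in> A. f x = b})"
    using assms by auto
  also have "card \<dots> = (\<Sum>b\<in>B. card ({x \<in> A. f x = b} \<times> {x \<in> A. f x = b}))"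
    using assms by (intro card_UN_disjoint) auto
  finally have c2: "card {(x, y) \<in> A \<times> A. f x = f y} = (\<Sum>b\<in>B. (?r b)\<^sup>2)"
    by (simp add: card_cartesian_product power2_eq_square)
  have "(\<Sum>b\<in>B. real (?r b))\<^sup>2 \<le> (\<Sum>b\<in>B. (real (?r b))\<^sup>2) * card B"
    by (rule sum_squared_le_sum_of_squares)
  then have "real ((card A)\<^sup>2) \<le> real (card B * card {(x, y) \<in> A \<times> A. f x = f y})"
    unfolding cA c2 by (simp add: mult.commute)
  then show ?thesis by linarith
qed

section \<open>Colour sequences and greedy choices\<close>

text \<open>For a cycle the argument is \<open>xs @ [hd xs]\<close>, so that the closing edge
  contributes its colour.\<close>

fun cols :: "('a \<Rightarrow> 'a \<Rightarrow> 'c) \<Rightarrow> 'a list \<Rightarrow> 'c list" where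
  "cols c (x # y # xs) = c x y # cols c (y # xs)"
| "cols c _ = []"

lemma cols_Cons: "xs \<noteq> [] \<Longrightarrow> cols c (x # xs) = c x (hd xs) # cols c xs"
  by (cases xs) auto

lemma cols_append:
  "xs \<noteq> [] \<Longrightarrow> ys \<noteq> [] \<Longrightarrow> cols c (xs @ ys) = cols c xs @ c (last xs) (hd ys) # cols c ys"
  by (induction c xs rule: cols.induct) (auto simp: cols_Cons)

lemma length_cols [simp]: "length (cols c xs) = length xs - 1"
  by (induction c xs rule: cols.induct) auto

text \<open>The greedy step: a new vertex may clash in up to four ways, and \<open>False\<close>
  fills the places of clashes that do not occur.\<close>

lemma exists_outside:
  assumes "finite U"
    "card {x \<in> U. P x} + card {x \<in> U. Q x} + card {x \<in> U. R x} + card {x \<in> U. S x} < card U"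
  shows "\<exists>x\<in>U. \<not> P x \<and> \<not> Q x \<and> \<not> R x \<and> \<not> S x"
proof (rule ccontr)
  assume "\<not> ?thesis"
  then have "U = {x \<in> U. P x} \<union> ({x \<in> U. Q x} \<union> ({x \<in> U. R x} \<union> {x \<in> U. S x}))" by auto
  then have "card U = card ({x \<in> U. P x} \<union> ({x \<in> U. Q x} \<union> ({x \<in> U. R x} \<union> {x \<in> U. S x})))"
    by (rule arg_cong)
  also have "\<dots> \<le> card {x \<in> U. P x} + (card {x \<in> U. Q x} + (card {x \<in> U. R x} + card {x \<in> U. S x}))"
    by (intro order_trans[OF card_Un_le] add_mono order_refl)
  finally show False using assms(2) by linarith
qed

lemma card_le_one_if_unique:
  assumes "\<And>x y. x \<in> A \<Longrightarrow> y \<in> A \<Longrightarrow> x = y"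
  shows "card A \<le> 1"
proof (cases "A = {}")
  case False
  then obtain a where "a \<in> A" by blast
  with assms have "A = {a}" by blast
  then show ?thesis by simp
qed simp

lemma card_filter_le: "finite S \<Longrightarrow> card S \<le> s \<Longrightarrow> card {p \<in> U. p \<in> S} \<le> s"
  by (rule order_trans[OF card_mono]) auto

subsection \<open>Rainbow paths in graphs of large minimum degree\<close>

text \<open>Adjacency and colours are binary functions so that cycles can be handled as lists; being
  rainbow is distinctness of the closed colour sequence.\<close>

locale rainbow_cycle_free =
  fixes V :: "'a set" and adj :: "'a \<Rightarrow> 'a \<Rightarrow> bool" and col :: "'a \<Rightarrow> 'a \<Rightarrow> 'c" and k :: nat
  assumes finite_V: "finite V"
    and adj_V: "adj x y \<Longrightarrow> x \<in> V"
    and adj_sym: "adj x y \<Longrightarrow> adj y x"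
    and adj_irrefl: "\<not> adj x x"
    and col_sym: "col x y = col y x"
    and proper: "adj x y \<Longrightarrow> adj x z \<Longrightarrow> col x y = col x z \<Longrightarrow> y = z"
    and k_ge_2: "2 \<le> k"
    and no_rainbow_cycle: "length xs = 2 * k \<Longrightarrow> distinct xs \<Longrightarrow> successively adj (xs @ [hd xs]) \<Longrightarrow>
          distinct (cols col (xs @ [hd xs])) \<Longrightarrow> False"
begin

definition nb :: "'a \<Rightarrow> 'a set" where "nb u = {v. adj u v}"

abbreviation deg :: "'a \<Rightarrow> nat" where "deg u \<equiv> card (nb u)"

lemma adj_V': "adj x y \<Longrightarrow> y \<in> V"
  using adj_V adj_sym by blast

lemma proper': "adj y x \<Longrightarrow> adj z x \<Longrightarrow> col y x = col z x \<Longrightarrow> y = z"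
  using proper adj_sym col_sym by metis

lemma nb_subset: "nb u \<subseteq> V"
  using adj_V' by (auto simp: nb_def)

lemma finite_nb [simp]: "finite (nb u)"
  using nb_subset finite_V finite_subset by blast

lemma deg_le: "deg u \<le> card V"
  using nb_subset finite_V by (simp add: card_mono)

lemma finite_rel [simp]:
  "finite {(p, y). adj u p \<and> adj p y \<and> P p y}"
  by (rule finite_subset[of _ "V \<times> V"]) (use adj_V adj_V' finite_V in auto)

text \<open>At \<open>u\<close> a colour determines the neighbour \<open>f x\<close> by properness,
  so \<open>s\<close> forbidden colours exclude at most \<open>s\<close> fibres of
  \<open>f\<close>.\<close>

lemma card_col_fibres:
  assumes "finite U" "finite S" "card S \<le> s"
    and "\<And>x. x \<in> U \<Longrightarrow> adj u (f x)" "\<And>v. card {x \<in> U. f x = v} \<le> c"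
  shows "card {x \<in> U. col u (f x) \<in> S} \<le> c * s"
proof (rule card_fibres_bound[OF assms(1,2) _ assms(3)])
  fix g
  show "card {x \<in> U. col u (f x) = g} \<le> c"
  proof (cases "{x \<in> U. col u (f x) = g} = {}")
    case True
    show ?thesis unfolding True by simp
  next
    case False
    then obtain y where y: "y \<in> U" "col u (f y) = g" by auto
    have "f x = f y" if "x \<in> U" "col u (f x) = g" for x
      by (rule proper[OF assms(4)[OF that(1)] assms(4)[OF y(1)]]) (simp add: that(2) y(2))
    then have "card {x \<in> U. col u (f x) = g} \<le> card {x \<in> U. f x = f y}"
      using assms(1) by (intro card_mono) auto
    then show ?thesis using assms(5)[of "f y"] by linarith
  qed
qed

lemma card_col_fibre:
  assumes "finite U" "finite S" "card S \<le> s" "\<And>p. p \<in> U \<Longrightarrow> adj u p"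
  shows "card {p \<in> U. col u p \<in> S} \<le> s"
proof -
  have "card {p \<in> U. col u p \<in> S} \<le> 1 * s"
  proof (rule card_col_fibres[OF assms])
    show "card {x \<in> U. x = v} \<le> 1" for v by (rule card_le_one_if_unique) simp
  qed
  then show ?thesis by simp
qed

text \<open>The path grows greedily at its head, two edges at a time. An index \<open>x\<close>
  stands for the vertex \<open>w x\<close> and may carry further data, as the pairs
  \<open>(p, b)\<close> with \<open>w = snd\<close> do later.\<close>

lemma rainbow_path:
  fixes F :: "('x \<times> 'a) set" and w :: "'x \<Rightarrow> 'a"
  assumes fin: "finite F"
    and adjF: "\<And>x m. (x, m) \<in> F \<Longrightarrow> adj (w x) m"
    and colF: "\<And>x m. (x, m) \<in> F \<Longrightarrow> col (w x) m \<in> Cs"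
    and fib: "\<And>b m. card {x. (x, m) \<in> F \<and> w x = b} \<le> c"
    and deg: "\<And>x m. (x, m) \<in> F \<Longrightarrow> D \<le> card {m'. (x, m') \<in> F} \<and> D \<le> card {x'. (x', m) \<in> F}"
    and c: "1 \<le> c" and D: "c * (4 * J) < D"
    and m: "m \<in> snd ` F"
    and "j \<le> J"
  shows "\<exists>zs. length zs = 2 * j + 1 \<and> distinct zs \<and> successively adj zs \<and> last zs = m \<and>
    hd zs \<in> snd ` F \<and> set zs \<subseteq> w ` fst ` F \<union> snd ` F \<and>
    distinct (cols col zs) \<and> set (cols col zs) \<subseteq> Cs"
  using \<open>j \<le> J\<close>
proof (induction j)
  case 0
  then show ?case using m by (intro exI[of _ "[m]"]) auto
next
  case (Suc j)
  then obtain zs where zs: "length zs = 2 * j + 1" "distinct zs" "successively adj zs" "last zs = m"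
    "hd zs \<in> snd ` F" "set zs \<subseteq> w ` fst ` F \<union> snd ` F" "distinct (cols col zs)" "set (cols col zs) \<subseteq> Cs"
    by auto
  have ne: "zs \<noteq> []" using zs(1) by auto
  have cz: "card (set zs) \<le> 2 * j + 1" "card (set (cols col zs)) \<le> 2 * j"
    using card_length[of zs] card_length[of "cols col zs"] zs(1) by auto
  let ?X = "{x. (x, hd zs) \<in> F}"
  have finX: "finite ?X" by (rule finite_subset[of _ "fst ` F"]) (use fin in force)+
  have DX: "D \<le> card ?X" using zs(5) deg by force
  have b1: "card {x \<in> ?X. w x \<in> set zs} \<le> c * (2 * j + 1)"
    using finX by (rule card_fibres_bound[OF _ _ _ cz(1)]) (use fib in \<open>simp_all\<close>)
  have b2: "card {x \<in> ?X. col (w x) (hd zs) \<in> set (cols col zs)} \<le> c * (2 * j)"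
    unfolding col_sym[of _ "hd zs"]
    using finX cz(2) fib adjF adj_sym by (intro card_col_fibres) auto
  \<comment> \<open>The path blocks \<open>2 * j + 1\<close> vertices and \<open>2 * j\<close>
    colours, each excluding at most \<open>c\<close> indices; \<open>Suc j \<le> J\<close> gives
    \<open>4 * j + 1 \<le> 4 * J\<close>.\<close>
  have "c * (2 * j + 1) + c * (2 * j) < D"
  proof -
    have "c * (2 * j + 1) + c * (2 * j) = c * (4 * j + 1)" by (simp add: algebra_simps)
    also have "\<dots> \<le> c * (4 * J)" using Suc.prems by (intro mult_left_mono) auto
    finally show ?thesis using D by linarith
  qed
  then have "\<exists>x\<in>?X. \<not> w x \<in> set zs \<and> \<not> col (w x) (hd zs) \<in> set (cols col zs) \<and> \<not> False \<and> \<not> False"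
    using b1 b2 DX by (intro exists_outside[OF finX]) simp
  then obtain x where x: "(x, hd zs) \<in> F" "w x \<notin> set zs" "col (w x) (hd zs) \<notin> set (cols col zs)" by auto
  let ?M = "{m'. (x, m') \<in> F}"
  have finM: "finite ?M" by (rule finite_subset[of _ "snd ` F"]) (use fin in force)+
  have DM: "D \<le> card ?M" using x(1) deg by force
  have b3: "card {m' \<in> ?M. m' \<in> set zs} \<le> 1 * (2 * j + 1)"
    using cz(1) by (simp only: mult_1 card_filter_le List.finite_set)
  have b4: "card {m' \<in> ?M. col (w x) m' \<in> insert (col (w x) (hd zs)) (set (cols col zs))} \<le> 1 * (2 * j + 1)"
  proof (intro card_fibres_bound finM)
    show "card {m' \<in> ?M. col (w x) m' = v} \<le> 1" for v
      using proper adjF by (intro card_le_one_if_unique) blast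
    show "card (insert (col (w x) (hd zs)) (set (cols col zs))) \<le> 2 * j + 1"
      using cz(2) by (simp add: card_insert_if)
  qed auto
  have "1 * (2 * j + 1) + 1 * (2 * j + 1) < D"
  proof -
    have "4 * j + 2 \<le> 1 * (4 * J)" using Suc.prems by simp
    also have "\<dots> \<le> c * (4 * J)" using c by (intro mult_right_mono) auto
    finally show ?thesis using D by simp
  qed
  then have "\<exists>m'\<in>?M. \<not> m' \<in> set zs \<and> \<not> col (w x) m' \<in> insert (col (w x) (hd zs)) (set (cols col zs))
      \<and> \<not> False \<and> \<not> False"
    using b3 b4 DM by (intro exists_outside[OF finM]) simp
  then obtain m' where m': "(x, m') \<in> F" "m' \<notin> set zs" "col (w x) m' \<noteq> col (w x) (hd zs)"
    "col (w x) m' \<notin> set (cols col zs)" by auto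
  have "m' \<noteq> w x" using adjF[OF m'(1)] adj_irrefl by auto
  then show ?case
    using zs ne x m' adjF[OF m'(1)] adjF[OF x(1)] adj_sym colF[OF m'(1)] colF[OF x(1)]
    by (intro exI[of _ "m' # w x # zs"])
      (auto simp: successively_Cons cols_Cons col_sym[of m' "w x"] image_iff intro: rev_bexI)
qed

section \<open>Walks of length two from a vertex\<close>

text \<open>Each greedy choice below faces at most four kinds of clash, each excluding at most
  \<open>2 * k\<close> candidates.\<close>

definition D1 :: nat where "D1 = 8 * k + 1"

text \<open>Otherwise the core of minimum degree \<open>D1\<close> contains a rainbow path with
  \<open>2 * k - 4\<close> edges from \<open>hd zs\<close> to \<open>m\<close>. Two edges through
  \<open>p'\<close> and two through \<open>p\<close> close it at \<open>u\<close> to a rainbow cycle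
  of length \<open>2 * k\<close>. For \<open>k = 2\<close> the path is a single vertex.\<close>

lemma edges_from_neighbourhood:
  assumes "finite Y"
  shows "card {(p, y). adj u p \<and> adj p y \<and> y \<in> Y \<and> y \<noteq> u} \<le> D1 * (deg u + card Y)"
proof (rule ccontr)
  let ?F = "{(p, y). adj u p \<and> adj p y \<and> y \<in> Y \<and> y \<noteq> u}"
  assume neg: "\<not> ?thesis"
  have sub: "?F \<subseteq> nb u \<times> Y" by (auto simp: nb_def)
  obtain F where F: "F \<subseteq> ?F" "card ?F \<le> card F + D1 * (deg u + card Y)"
    and Fdeg: "\<And>x m. (x, m) \<in> F \<Longrightarrow> D1 \<le> card {m'. (x, m') \<in> F} \<and> D1 \<le> card {x'. (x', m) \<in> F}"
    by (rule min_degree_core[OF _ _ sub, of D1]) (use assms in auto)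
  have "card F > 0" using F neg by linarith
  then obtain m where m: "m \<in> snd ` F" by (metis card_gt_0_iff equals0I imageI)
  have finF: "finite F" by (rule finite_subset[OF F(1) finite_rel])
  have "\<exists>zs. length zs = 2 * (k - 2) + 1 \<and> distinct zs \<and> successively adj zs \<and> last zs = m \<and>
    hd zs \<in> snd ` F \<and> set zs \<subseteq> id ` fst ` F \<union> snd ` F \<and>
    distinct (cols col zs) \<and> set (cols col zs) \<subseteq> UNIV"
  proof (rule rainbow_path[where D = D1 and J = "k - 2" and c = 1])
    show "card {x. (x, m) \<in> F \<and> id x = b} \<le> 1" for b m
      by (intro card_le_one_if_unique) auto
  qed (use finF F(1) Fdeg m in \<open>auto simp: D1_def\<close>)
  then obtain zs where zs: "length zs = 2 * (k - 2) + 1" "distinct zs" "successively adj zs" "last zs = m"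
    "hd zs \<in> snd ` F" "set zs \<subseteq> fst ` F \<union> snd ` F" "distinct (cols col zs)"
    by auto
  have ne: "zs \<noteq> []" using zs(1) by auto
  have lz: "length zs \<le> 2 * k - 3" "length (cols col zs) \<le> 2 * k - 4" using zs(1) k_ge_2 by auto
  have cz: "card (set zs) \<le> 2 * k - 3" "card (set (cols col zs)) \<le> 2 * k - 4"
    using lz card_length order_trans by metis+
  have u: "u \<notin> set zs" using zs(6) F(1) adj_irrefl by fastforce
  let ?m = "hd zs"
  let ?X = "\<lambda>m. {x. (x, m) \<in> F}"
  have finX: "finite (?X m)" for m by (rule finite_subset[of _ "fst ` F"]) (use finF in force)+
  have adjX: "adj u p" "adj p m" "adj m p" if "p \<in> ?X m" for p m using that F(1) adj_sym by auto
  have DX: "8 * k + 1 \<le> card (?X ?m)" "8 * k + 1 \<le> card (?X m)"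
    using zs(5) m Fdeg unfolding D1_def by force+
  have "\<exists>p\<in>?X ?m. \<not> p \<in> set zs \<and> \<not> col ?m p \<in> set (cols col zs) \<and> \<not> col u p \<in> set (cols col zs) \<and> \<not> False"
  proof (rule exists_outside[OF finX])
    have "card {p \<in> ?X ?m. p \<in> set zs} \<le> 2 * k" using cz by (intro card_filter_le) auto
    moreover have "card {p \<in> ?X ?m. col ?m p \<in> set (cols col zs)} \<le> 2 * k"
      using cz finX adjX by (intro card_col_fibre) auto
    moreover have "card {p \<in> ?X ?m. col u p \<in> set (cols col zs)} \<le> 2 * k"
      using cz finX adjX by (intro card_col_fibre) auto
    ultimately show "card {p \<in> ?X ?m. p \<in> set zs} + card {p \<in> ?X ?m. col ?m p \<in> set (cols col zs)} +
      card {p \<in> ?X ?m. col u p \<in> set (cols col zs)} + card {p \<in> ?X ?m. False} < card (?X ?m)"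
      using DX by simp
  qed
  then obtain p' where p': "p' \<in> ?X ?m" "p' \<notin> set zs" "col ?m p' \<notin> set (cols col zs)"
    "col u p' \<notin> set (cols col zs)" by auto
  \<comment> \<open>\<open>col u p'\<close> is left out of \<open>?S3\<close> because properness at
    \<open>u\<close> already separates it from \<open>col u p\<close>.\<close>
  let ?S1 = "insert p' (set zs)" and ?S2 = "insert (col ?m p') (insert (col u p') (set (cols col zs)))"
    and ?S3 = "insert (col ?m p') (set (cols col zs))"
  have c1: "card ?S1 \<le> 2 * k" "card ?S2 \<le> 2 * k" "card ?S3 \<le> 2 * k"
    using cz k_ge_2 by (auto simp: card_insert_if)
  have "\<exists>p\<in>?X m. \<not> p \<in> ?S1 \<and> \<not> col m p \<in> ?S2 \<and> \<not> col u p \<in> ?S3 \<and> \<not> False"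
  proof (rule exists_outside[OF finX])
    have "card {p \<in> ?X m. p \<in> ?S1} \<le> 2 * k" using c1(1) by (intro card_filter_le) auto
    moreover have "card {p \<in> ?X m. col m p \<in> ?S2} \<le> 2 * k"
      using c1(2) finX adjX by (intro card_col_fibre) auto
    moreover have "card {p \<in> ?X m. col u p \<in> ?S3} \<le> 2 * k"
      using c1(3) finX adjX by (intro card_col_fibre) auto
    ultimately show "card {p \<in> ?X m. p \<in> ?S1} + card {p \<in> ?X m. col m p \<in> ?S2} +
      card {p \<in> ?X m. col u p \<in> ?S3} + card {p \<in> ?X m. False} < card (?X m)"
      using DX by simp
  qed
  then obtain p where p: "p \<in> ?X m" "p \<notin> ?S1" "col m p \<notin> ?S2" "col u p \<notin> ?S3" by auto
  have um: "u \<noteq> m" "u \<noteq> ?m" using m zs(5) F(1) by auto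
  have c2: "col u p' \<noteq> col ?m p'" using proper' adjX[OF p'(1)] um by metis
  have c3: "col m p \<noteq> col u p" using proper' adjX[OF p(1)] um by metis
  have c4: "col u p' \<noteq> col u p" using proper adjX(1)[OF p'(1)] adjX(1)[OF p(1)] p(2) by auto
  have up: "u \<noteq> p" "u \<noteq> p'" using adjX(1)[OF p'(1)] adjX(1)[OF p(1)] adj_irrefl by auto
  let ?xs = "u # p' # zs @ [p]"
  have "cols col (?xs @ [hd ?xs]) = col u p' # col ?m p' # cols col zs @ [col m p, col u p]"
    using ne zs(4) by (simp add: cols_Cons cols_append col_sym[of p' ?m] col_sym[of p u])
  then have dc: "distinct (cols col (?xs @ [hd ?xs]))"
    using zs(7) p' p c2 c3 c4 by auto
  have "successively adj (?xs @ [hd ?xs])"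
    using ne zs(3,4) adjX[OF p'(1)] adjX[OF p(1)] adj_sym
    by (auto simp: successively_append_iff successively_Cons)
  moreover have "distinct ?xs" using zs(2) p' p u up by auto
  moreover have "length ?xs = 2 * k" using zs(1) k_ge_2 by simp
  ultimately show False using no_rainbow_cycle dc by blast
qed

text \<open>The case \<open>Y = V\<close>; walks that return to \<open>u\<close> add another
  \<open>deg u\<close>.\<close>

lemma two_walks_from: "card {(p, y). adj u p \<and> adj p y} \<le> 3 * D1 * card V"
proof -
  have "{(p, y). adj u p \<and> adj p y} \<subseteq>
      {(p, y). adj u p \<and> adj p y \<and> y \<in> V \<and> y \<noteq> u} \<union> (\<lambda>p. (p, u)) ` nb u"
    using adj_V' by (auto simp: nb_def)
  then have "card {(p, y). adj u p \<and> adj p y} \<le>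
      card ({(p, y). adj u p \<and> adj p y \<and> y \<in> V \<and> y \<noteq> u} \<union> (\<lambda>p. (p, u)) ` nb u)"
    by (intro card_mono) auto
  also have "\<dots> \<le> D1 * (deg u + card V) + deg u"
    using edges_from_neighbourhood[OF finite_V, of u] card_image_le[OF finite_nb, of "\<lambda>p. (p, u)" u]
    by (intro order_trans[OF card_Un_le] add_mono)
  also have "\<dots> \<le> D1 * (card V + card V) + D1 * card V"
  proof -
    have "deg u \<le> 1 * card V" using deg_le by simp
    also have "\<dots> \<le> D1 * card V" by (intro mult_right_mono) (auto simp: D1_def)
    finally show ?thesis using deg_le by (intro add_mono mult_left_mono) auto
  qed
  finally show ?thesis by (simp add: algebra_simps)
qed

text \<open>The threshold is twice the constant of \<open>edges_from_neighbourhood\<close>, so that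
  in \<open>big_two_walks_from\<close> the term \<open>D1 * card Y\<close> is absorbed by the lower
  bound \<open>2 * D1 * card Y\<close>.\<close>

definition big :: "'a \<Rightarrow> 'a \<Rightarrow> bool" where
  "big x y \<longleftrightarrow> x \<noteq> y \<and> 2 * D1 \<le> card (nb x \<inter> nb y)"

lemma big_sym: "big x y \<Longrightarrow> big y x"
  by (auto simp: big_def Int_commute)

lemma not_bigD: "\<not> big x y \<Longrightarrow> x \<noteq> y \<Longrightarrow> card {z. adj x z \<and> adj y z} \<le> 2 * D1"
  by (auto simp: big_def nb_def Int_def)

text \<open>Each \<open>y \<in> Y\<close> receives \<open>2 D1\<close> edges from the neighbourhood, which forces \<open>card Y \<le> deg b\<close>.\<close>

lemma big_two_walks_from: "card {(p, y). adj b p \<and> adj p y \<and> big b y} \<le> 2 * D1 * deg b"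
proof -
  let ?S = "{(p, y). adj b p \<and> adj p y \<and> big b y}"
  define Y where "Y = {y. big b y}"
  have "Y \<subseteq> V"
  proof
    fix y assume "y \<in> Y"
    then have "nb b \<inter> nb y \<noteq> {}" by (auto simp: Y_def big_def D1_def)
    then show "y \<in> V" using adj_V by (auto simp: nb_def)
  qed
  then have fY: "finite Y" using finite_V finite_subset by blast
  have "?S = {(p, y). adj b p \<and> adj p y \<and> y \<in> Y \<and> y \<noteq> b}" by (auto simp: Y_def big_def)
  then have le: "card ?S \<le> D1 * (deg b + card Y)" using edges_from_neighbourhood[OF fY] by simp
  have "prod.swap ` ?S = (SIGMA y:Y. nb b \<inter> nb y)"
    using adj_sym by (auto simp: Y_def nb_def)
  then have "card ?S = card (SIGMA y:Y. nb b \<inter> nb y)"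
    using card_image[of prod.swap ?S] by (simp add: inj_on_def)
  also have "\<dots> = (\<Sum>y\<in>Y. card (nb b \<inter> nb y))" using fY by simp
  also have "\<dots> \<ge> (\<Sum>y\<in>Y. 2 * D1)" by (intro sum_mono) (auto simp: Y_def big_def)
  finally have ge: "2 * D1 * card Y \<le> card ?S" by (simp add: mult.commute)
  have "D1 * card Y \<le> D1 * deg b" using le ge unfolding distrib_left mult.assoc by linarith
  then show ?thesis using le unfolding distrib_left mult.assoc by linarith
qed

subsection \<open>Walks of length three\<close>

definition two_walks :: "('a \<times> 'a \<times> 'a) set" where
  "two_walks = {(u, p, y). adj u p \<and> adj p y}"

definition three_walks :: "('a \<times> 'a \<times> 'a \<times> 'a) set" where
  "three_walks = {(u, p, b, m). adj u p \<and> adj p b \<and> adj b m}"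

lemma finite_two_walks [simp]: "finite two_walks"
  by (rule finite_subset[of _ "V \<times> V \<times> V"]) (use adj_V adj_V' finite_V in \<open>auto simp: two_walks_def\<close>)

lemma finite_three_walks [simp]: "finite three_walks"
  by (rule finite_subset[of _ "V \<times> V \<times> V \<times> V"]) (use adj_V adj_V' finite_V in \<open>auto simp: three_walks_def\<close>)

lemma card_two_walks: "card two_walks \<le> 3 * D1 * (card V)\<^sup>2"
proof -
  have "two_walks = (SIGMA u:V. {(p, y). adj u p \<and> adj p y})" using adj_V by (auto simp: two_walks_def)
  also have "card \<dots> = (\<Sum>u\<in>V. card {(p, y). adj u p \<and> adj p y})"
    using finite_V by (intro card_SigmaI) (auto intro: finite_rel[where P = "\<lambda>_ _. True", simplified])
  also have "\<dots> \<le> (\<Sum>u\<in>V. 3 * D1 * card V)" by (intro sum_mono two_walks_from)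
  finally show ?thesis by (simp add: power2_eq_square mult_ac)
qed

text \<open>Split at the middle vertex; sums of \<open>deg b * deg b\<close> thus become numbers of
  walks.\<close>

lemma card_two_walks_deg: "card two_walks = (\<Sum>p\<in>V. deg p * deg p)"
proof -
  have "card two_walks = card (SIGMA p:V. nb p \<times> nb p)"
    by (rule bij_betw_same_card[of "\<lambda>(u, p, y). (p, u, y)"], rule bij_betwI[where g = "\<lambda>(p, u, y). (u, p, y)"])
      (use adj_V adj_V' adj_sym in \<open>auto simp: two_walks_def nb_def\<close>)
  then show ?thesis using finite_V by (simp add: card_cartesian_product)
qed

lemma card_three_walks_deg: "card three_walks = (\<Sum>(p, b)\<in>{(p, b). adj p b}. deg p * deg b)"
proof -
  have fin: "finite {(p, b). adj p b}"
    by (rule finite_subset[of _ "V \<times> V"]) (use adj_V adj_V' finite_V in auto)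
  have "card three_walks = card (SIGMA e:{(p, b). adj p b}. nb (fst e) \<times> nb (snd e))"
    by (rule bij_betw_same_card[of "\<lambda>(u, p, b, m). ((p, b), u, m)"],
        rule bij_betwI[where g = "\<lambda>((p, b), u, m). (u, p, b, m)"])
      (use adj_V adj_V' adj_sym in \<open>auto simp: three_walks_def nb_def\<close>)
  then show ?thesis using fin by (simp add: card_cartesian_product case_prod_beta)
qed

text \<open>Properness separates the colours of adjacent edges, so a good walk is a rainbow path.
  The conditions on \<open>big\<close> leave at most \<open>2 * D1\<close> good walks from
  \<open>u\<close> with given \<open>b\<close> and \<open>m\<close>, or with given \<open>p\<close>
  and \<open>m\<close>.\<close>

definition good :: "'a \<Rightarrow> 'a \<Rightarrow> 'a \<Rightarrow> 'a \<Rightarrow> bool" where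
  "good u p b m \<longleftrightarrow> adj u p \<and> adj p b \<and> adj b m \<and> u \<noteq> b \<and> p \<noteq> m \<and> u \<noteq> m \<and>
     \<not> big u b \<and> \<not> big p m \<and> col u p \<noteq> col b m"

text \<open>A walk that repeats a vertex or has equal end colours is determined by a two-walk. A
  walk with \<open>big u b\<close> is one of at most \<open>2 * D1 * deg b\<close> big two-walks
  from \<open>b\<close> together with a neighbour of \<open>b\<close>; summing over \<open>b\<close>
  gives a multiple of \<open>card two_walks\<close>.\<close>

lemma three_walks_good: "card three_walks \<le> card {(u, p, b, m). good u p b m} + (4 + 4 * D1) * card two_walks"
proof -
  let ?G = "{(u, p, b, m). good u p b m}"
  let ?B1 = "{(u, p, b, m) \<in> three_walks. u = b}" and ?B2 = "{(u, p, b, m) \<in> three_walks. p = m}"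
    and ?B3 = "{(u, p, b, m) \<in> three_walks. u = m}" and ?B4 = "{(u, p, b, m) \<in> three_walks. col u p = col b m}"
    and ?B5 = "{(u, p, b, m) \<in> three_walks. big u b}" and ?B6 = "{(u, p, b, m) \<in> three_walks. big p m}"
  have fin: "finite {w \<in> three_walks. P w}" for P by simp
  have "card ?B1 \<le> card two_walks"
    by (rule card_inj_on_le[of "\<lambda>(u, p, b, m). (p, u, m)"])
      (auto simp: inj_on_def three_walks_def two_walks_def adj_sym finite_two_walks[unfolded two_walks_def])
  moreover have "card ?B2 \<le> card two_walks"
    by (rule card_inj_on_le[of "\<lambda>(u, p, b, m). (u, p, b)"]) (auto simp: inj_on_def three_walks_def two_walks_def finite_two_walks[unfolded two_walks_def])
  moreover have "card ?B3 \<le> card two_walks"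
    by (rule card_inj_on_le[of "\<lambda>(u, p, b, m). (u, p, b)"]) (auto simp: inj_on_def three_walks_def two_walks_def finite_two_walks[unfolded two_walks_def])
  moreover have "card ?B4 \<le> card two_walks"
  proof (rule card_inj_on_le[of "\<lambda>(u, p, b, m). (u, p, b)"])
    have "m = m'" if "adj b m" "adj b m'" "col b m = c" "col b m' = c" for b m m' c
      using proper[OF that(1,2)] that by simp
    then show "inj_on (\<lambda>(u, p, b, m). (u, p, b)) ?B4" by (auto simp: inj_on_def three_walks_def)
  qed (auto simp: three_walks_def two_walks_def finite_two_walks[unfolded two_walks_def])
  moreover have S: "(\<Sum>b\<in>V. card {(p, y). adj b p \<and> adj p y \<and> big b y} * deg b) \<le> 2 * D1 * card two_walks"
    unfolding card_two_walks_deg sum_distrib_left mult.assoc[symmetric]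
    by (intro sum_mono mult_right_mono big_two_walks_from) auto
  have finS: "finite (SIGMA b:V. {(p, y). adj b p \<and> adj p y \<and> big b y} \<times> nb b)"
    by (intro finite_SigmaI finite_V finite_rel finite_nb)
  have "card ?B5 \<le> card (SIGMA b:V. {(p, y). adj b p \<and> adj p y \<and> big b y} \<times> nb b)"
    by (rule card_inj_on_le[of "\<lambda>(u, p, b, m). (b, (p, u), m)", OF _ _ finS])
      (use adj_V big_sym adj_sym in \<open>auto simp: inj_on_def three_walks_def nb_def\<close>)
  then have "card ?B5 \<le> 2 * D1 * card two_walks" using S finite_V by (simp add: card_cartesian_product)
  moreover have "card ?B6 \<le> card (SIGMA b:V. {(p, y). adj b p \<and> adj p y \<and> big b y} \<times> nb b)"
    by (rule card_inj_on_le[of "\<lambda>(u, p, b, m). (p, (b, m), u)", OF _ _ finS])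
      (use adj_V big_sym adj_sym in \<open>auto simp: inj_on_def three_walks_def nb_def\<close>)
  then have "card ?B6 \<le> 2 * D1 * card two_walks" using S finite_V by (simp add: card_cartesian_product)
  moreover have "card three_walks \<le> card ?G + (card ?B1 + (card ?B2 + (card ?B3 + (card ?B4 + (card ?B5 + card ?B6)))))"
  proof -
    have GW: "?G \<subseteq> three_walks" by (auto simp: good_def three_walks_def)
    have "three_walks = ?G \<union> (?B1 \<union> (?B2 \<union> (?B3 \<union> (?B4 \<union> (?B5 \<union> ?B6)))))"
      using GW by (auto simp: good_def three_walks_def)
    then have "card three_walks = card (?G \<union> (?B1 \<union> (?B2 \<union> (?B3 \<union> (?B4 \<union> (?B5 \<union> ?B6))))))"
      by (rule arg_cong)
    also have "\<dots> \<le> card ?G + (card ?B1 + (card ?B2 + (card ?B3 + (card ?B4 + (card ?B5 + card ?B6)))))"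
      by (intro order_trans[OF card_Un_le] add_mono order_refl)
    finally show ?thesis .
  qed
  ultimately show ?thesis by (simp add: algebra_simps)
qed

section \<open>Concentration of the middle colour\<close>

text \<open>Four kinds of clash, each with at most \<open>2 * k\<close> forbidden vertices or
  colours, and at most \<open>2 * D1\<close> pairs \<open>(p, b)\<close> for each of these.\<close>

definition D2 :: nat where "D2 = 16 * k * D1 + 1"

text \<open>Since middle colours lie in \<open>S\<close> and all other colours do not, a middle colour can only clash
  with the other middle colour of the cycle.\<close>

lemma concentrated_core:
  assumes k3: "3 \<le> k"
    and F: "\<And>p b m. ((p, b), m) \<in> F \<Longrightarrow> good u p b m \<and> col p b \<in> S \<and> col u p \<notin> S \<and> col b m \<notin> S"
    and Fdeg: "\<And>x m. (x, m) \<in> F \<Longrightarrow> D2 \<le> card {m'. (x, m') \<in> F} \<and> D2 \<le> card {x'. (x', m) \<in> F}"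
    and m: "m \<in> snd ` F"
  shows "\<exists>g. card {x. (x, m) \<in> F \<and> col (fst x) (snd x) \<noteq> g} < D2"
proof (rule ccontr)
  assume "\<not> ?thesis"
  then have neg: "D2 \<le> card {x. (x, m) \<in> F \<and> col (fst x) (snd x) \<noteq> g}" for g by (meson not_le)
  let ?X = "\<lambda>m. {x. (x, m) \<in> F}"
  have finF: "finite F"
    by (rule finite_subset[of _ "(V \<times> V) \<times> V"]) (use F adj_V adj_V' finite_V in \<open>force simp: good_def\<close>)+
  have finX: "finite (?X m)" for m by (rule finite_subset[of _ "fst ` F"]) (use finF in force)+
  have X: "adj u (fst x)" "adj (fst x) (snd x)" "adj m (snd x)" "adj (snd x) m"
    "u \<noteq> snd x" "u \<noteq> m" "fst x \<noteq> m" "\<not> big u (snd x)" "\<not> big (fst x) m" "col u (fst x) \<noteq> col (snd x) m"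
    "col (fst x) (snd x) \<in> S" "col u (fst x) \<notin> S" "col (snd x) m \<notin> S"
    if "(x, m) \<in> F" for x m
    using F[of "fst x" "snd x" m] that adj_sym by (auto simp: good_def)
  have fib2: "card {x. (x, m) \<in> F \<and> snd x = b} \<le> 2 * D1" for b m
  proof (cases "{x. (x, m) \<in> F \<and> snd x = b} = {}")
    case True
    show ?thesis unfolding True by simp
  next
    case False
    then have ub: "\<not> big u b" "u \<noteq> b" using X by blast+
    have "{x. (x, m) \<in> F \<and> snd x = b} \<subseteq> (\<lambda>p. (p, b)) ` {p. adj u p \<and> adj b p}"
      using X adj_sym by force
    moreover have fin: "finite {p. adj u p \<and> adj b p}"
      by (rule finite_subset[OF _ finite_V]) (use adj_V' in auto)
    ultimately have "card {x. (x, m) \<in> F \<and> snd x = b} \<le> card {p. adj u p \<and> adj b p}"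
      by (meson surj_card_le)
    then show ?thesis using not_bigD[OF ub] by linarith
  qed
  have fib1: "card {x. (x, m) \<in> F \<and> fst x = p} \<le> 2 * D1" for p m
  proof (cases "{x. (x, m) \<in> F \<and> fst x = p} = {}")
    case True
    show ?thesis unfolding True by simp
  next
    case False
    then have ub: "\<not> big p m" "p \<noteq> m" using X by blast+
    have "{x. (x, m) \<in> F \<and> fst x = p} \<subseteq> (\<lambda>b. (p, b)) ` {b. adj p b \<and> adj m b}"
      using X adj_sym by force
    moreover have fin: "finite {b. adj p b \<and> adj m b}"
      by (rule finite_subset[OF _ finite_V]) (use adj_V' in auto)
    ultimately have "card {x. (x, m) \<in> F \<and> fst x = p} \<le> card {b. adj p b \<and> adj m b}"
      by (meson surj_card_le)
    then show ?thesis using not_bigD[OF ub] by linarith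
  qed
  \<comment> \<open>Vertices \<open>b\<close> and \<open>m\<close> alternate on this path, and its
    colours avoid \<open>S\<close>. Its \<open>2 * k - 6\<close> edges and two walks of length three
    from \<open>u\<close> to its ends make up \<open>2 * k\<close> edges.\<close>
  have "\<exists>zs. length zs = 2 * (k - 3) + 1 \<and> distinct zs \<and> successively adj zs \<and> last zs = m \<and>
    hd zs \<in> snd ` F \<and> set zs \<subseteq> snd ` fst ` F \<union> snd ` F \<and>
    distinct (cols col zs) \<and> set (cols col zs) \<subseteq> - S"
  proof (rule rainbow_path[where D = D2 and J = "k - 3" and c = "2 * D1"])
    have "2 * D1 * (4 * (k - 3)) \<le> 2 * D1 * (4 * k)" by (intro mult_left_mono) auto
    also have "\<dots> < D2" by (simp add: D2_def)
    finally show "2 * D1 * (4 * (k - 3)) < D2" .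
  qed (use finF X Fdeg fib2 m in \<open>auto simp: D1_def\<close>)
  then obtain zs where zs: "length zs = 2 * (k - 3) + 1" "distinct zs" "successively adj zs" "last zs = m"
    "hd zs \<in> snd ` F" "set zs \<subseteq> snd ` fst ` F \<union> snd ` F" "distinct (cols col zs)" "set (cols col zs) \<subseteq> - S"
    by auto
  have ne: "zs \<noteq> []" using zs(1) by auto
  have lz: "length zs \<le> 2 * k - 5" "length (cols col zs) \<le> 2 * k - 6" using zs(1) k3 by auto
  have cz: "card (set zs) \<le> 2 * k - 5" "card (set (cols col zs)) \<le> 2 * k - 6"
    using lz card_length order_trans by metis+
  have u: "u \<notin> set zs"
  proof
    assume "u \<in> set zs"
    then obtain x m' where "(x, m') \<in> F" "u = snd x \<or> u = m'" using zs(6) by (force simp: image_iff)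
    then show False using X(5,6) by blast
  qed
  let ?m = "hd zs"
  have DX: "8 * (2 * D1 * k) + 1 \<le> card (?X ?m)"
    using zs(5) Fdeg unfolding D2_def by (force simp: mult_ac)
  \<comment> \<open>Nothing is asked of the middle colour of \<open>x\<close>: it lies in
    \<open>S\<close>, away from the colours of the path and of the other new edges.\<close>
  have pick: "\<exists>x\<in>Y. \<not> snd x \<in> A \<and> \<not> fst x \<in> A \<and> \<not> col m' (snd x) \<in> B \<and> \<not> col u (fst x) \<in> C"
    if "Y \<subseteq> ?X m'" "D2 \<le> card Y" "finite A" "finite B" "finite C"
      "card A \<le> 2 * k" "card B \<le> 2 * k" "card C \<le> 2 * k" for Y m' A B C
  proof (rule exists_outside)
    show finY: "finite Y" using that(1) finX finite_subset by blast
    have f: "card {x \<in> Y. Q x} \<le> card {x \<in> ?X m'. Q x}" for Q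
      using that(1) finX by (intro card_mono) auto
    have f1: "card {x \<in> Y. fst x = p} \<le> 2 * D1" for p
      using f[of "\<lambda>x. fst x = p"] fib1[of m' p] by simp
    have f2: "card {x \<in> Y. snd x = p} \<le> 2 * D1" for p
      using f[of "\<lambda>x. snd x = p"] fib2[of m' p] by simp
    have "card {x \<in> Y. snd x \<in> A} \<le> 2 * D1 * (2 * k)"
      by (rule card_fibres_bound) (use finY that f2 in auto)
    moreover have "card {x \<in> Y. fst x \<in> A} \<le> 2 * D1 * (2 * k)"
      by (rule card_fibres_bound) (use finY that f1 in auto)
    moreover have "card {x \<in> Y. col m' (snd x) \<in> B} \<le> 2 * D1 * (2 * k)"
      by (rule card_col_fibres) (use finY that f2 X in auto)
    moreover have "card {x \<in> Y. col u (fst x) \<in> C} \<le> 2 * D1 * (2 * k)"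
      by (rule card_col_fibres) (use finY that f1 X in auto)
    ultimately show "card {x \<in> Y. snd x \<in> A} + card {x \<in> Y. fst x \<in> A} +
      card {x \<in> Y. col m' (snd x) \<in> B} + card {x \<in> Y. col u (fst x) \<in> C} < card Y"
      using that(2) unfolding D2_def by (simp add: mult_ac)
  qed
  have "\<exists>x\<in>?X ?m. \<not> snd x \<in> set zs \<and> \<not> fst x \<in> set zs \<and> \<not> col ?m (snd x) \<in> set (cols col zs) \<and>
      \<not> col u (fst x) \<in> set (cols col zs)"
    by (rule pick) (use cz zs(5) Fdeg in force)+
  then obtain p' b' where x': "((p', b'), ?m) \<in> F" "b' \<notin> set zs" "p' \<notin> set zs"
    "col ?m b' \<notin> set (cols col zs)" "col u p' \<notin> set (cols col zs)" by auto
  let ?A = "insert b' (insert p' (set zs))" and ?B = "insert (col ?m b') (insert (col u p') (set (cols col zs)))"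
    and ?C = "insert (col ?m b') (set (cols col zs))"
  \<comment> \<open>The two middle colours are kept apart by drawing from the pairs whose colour is
    not \<open>col p' b'\<close>; \<open>neg\<close> provides \<open>D2\<close> of them.\<close>
  have "\<exists>x\<in>{x. (x, m) \<in> F \<and> col (fst x) (snd x) \<noteq> col p' b'}. \<not> snd x \<in> ?A \<and> \<not> fst x \<in> ?A \<and>
      \<not> col m (snd x) \<in> ?B \<and> \<not> col u (fst x) \<in> ?C"
  proof (rule pick)
    show "card ?A \<le> 2 * k" "card ?B \<le> 2 * k" "card ?C \<le> 2 * k"
      using cz k3 by (auto simp: card_insert_if)
  qed (use neg in auto)
  then obtain p b where x: "((p, b), m) \<in> F" "col p b \<noteq> col p' b'" "b \<notin> ?A" "p \<notin> ?A"
    "col m b \<notin> ?B" "col u p \<notin> ?C" by auto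
  note X1 = X[OF x'(1), simplified] and X2 = X[OF x(1), simplified]
  have up: "u \<noteq> p" "u \<noteq> p'" "p \<noteq> b" "p' \<noteq> b'" using X1 X2 adj_irrefl by auto
  have c4: "col u p' \<noteq> col u p" using proper[OF X1(1) X2(1)] x(4) by auto
  let ?xs = "u # p' # b' # zs @ [b, p]"
  have "cols col (?xs @ [hd ?xs]) =
      col u p' # col p' b' # col ?m b' # cols col zs @ [col m b, col p b, col u p]"
    using ne zs(4) by (simp add: cols_Cons cols_append col_sym[of b' ?m] col_sym[of p u] col_sym[of p b])
  moreover have "distinct (col u p' # col p' b' # col ?m b' # cols col zs @ [col m b, col p b, col u p])"
    using zs(7,8) x' x c4 X1 X2 unfolding col_sym[of b ] col_sym[of b'] by auto
  ultimately have dc: "distinct (cols col (?xs @ [hd ?xs]))" by simp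
  have "successively adj (?xs @ [hd ?xs])"
    using ne zs(3,4) X1 X2 adj_sym
    by (auto simp: successively_append_iff successively_Cons)
  moreover have "distinct ?xs" using zs(2) x' x u up X1 X2 by auto
  moreover have "length ?xs = 2 * k" using zs(1) k3 by simp
  ultimately show False using no_rainbow_cycle dc by blast
qed

text \<open>Consider the bipartite graph between two-walks \<open>(p, b)\<close> from
  \<open>u\<close> and ends \<open>m\<close>. Passing to its core loses \<open>O(n)\<close> edges,
  and in the core each \<open>m\<close> has fewer than \<open>D2\<close> pairs whose colour is not
  the concentrated one, \<open>\<gamma> m\<close>.\<close>

lemma unpopular_bound:
  assumes k3: "3 \<le> k"
  shows "\<exists>\<gamma>. card {(p, b, m). good u p b m \<and> col p b \<in> S \<and> col u p \<notin> S \<and> col b m \<notin> S \<and> col p b \<noteq> \<gamma> m}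
     \<le> D2 * (3 * D1 + 2) * card V"
proof -
  let ?G = "\<lambda>p b m. good u p b m \<and> col p b \<in> S \<and> col u p \<notin> S \<and> col b m \<notin> S"
  define W where "W = {((p, b), m) | p b m. ?G p b m}"
  let ?A = "{(p, b). adj u p \<and> adj p b}"
  have finA: "finite ?A" using finite_rel[where P = "\<lambda>_ _. True"] by simp
  have sub: "W \<subseteq> ?A \<times> V" using adj_V' by (auto simp: W_def good_def)
  obtain F where F: "F \<subseteq> W" "card W \<le> card F + D2 * (card ?A + card V)"
    and Fdeg: "\<And>x m. (x, m) \<in> F \<Longrightarrow> D2 \<le> card {m'. (x, m') \<in> F} \<and> D2 \<le> card {x'. (x', m) \<in> F}"
    by (rule min_degree_core[OF finA finite_V sub, of D2]) auto
  have finW: "finite W" using sub finA finite_V by (meson finite_SigmaI finite_subset)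
  have finF: "finite F" using F(1) finW finite_subset by blast
  have ex: "\<forall>m\<in>snd ` F. \<exists>g. card {x. (x, m) \<in> F \<and> col (fst x) (snd x) \<noteq> g} < D2"
    using concentrated_core[OF k3 _ Fdeg, of u S] F(1) by (auto simp: W_def)
  then obtain \<gamma> where \<gamma>: "\<And>m. m \<in> snd ` F \<Longrightarrow> card {x. (x, m) \<in> F \<and> col (fst x) (snd x) \<noteq> \<gamma> m} < D2"
    using bchoice[OF ex] by blast
  let ?U = "{(p, b, m). ?G p b m \<and> col p b \<noteq> \<gamma> m}"
  let ?N = "{e \<in> F. col (fst (fst e)) (snd (fst e)) \<noteq> \<gamma> (snd e)}"
  have "card ?U \<le> card ((W - F) \<union> ?N)"
    by (rule card_inj_on_le[of "\<lambda>(p, b, m). ((p, b), m)"])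
      (use finW finF in \<open>auto simp: inj_on_def W_def\<close>)
  also have "\<dots> \<le> card (W - F) + card ?N" by (rule card_Un_le)
  also have "card (W - F) \<le> D2 * (card ?A + card V)"
    using F finF by (simp add: card_Diff_subset)
  also have "card ?N \<le> D2 * card V"
  proof (rule card_le_fibres[where f = snd])
    show "snd ` ?N \<subseteq> V" using F(1) sub by auto
    fix m assume "m \<in> V"
    show "card {x \<in> ?N. snd x = m} \<le> D2"
    proof (cases "m \<in> snd ` F")
      case True
      have "{x \<in> ?N. snd x = m} = (\<lambda>x. (x, m)) ` {x. (x, m) \<in> F \<and> col (fst x) (snd x) \<noteq> \<gamma> m}" by force
      then have "card {x \<in> ?N. snd x = m} = card {x. (x, m) \<in> F \<and> col (fst x) (snd x) \<noteq> \<gamma> m}"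
        by (simp add: card_image inj_on_def)
      then show ?thesis using \<gamma>[OF True] by linarith
    next
      case False
      then have "{x \<in> ?N. snd x = m} = {}" by force
      then show ?thesis by (simp only: card.empty)
    qed
  qed (use finF finite_V in auto)
  also have "D2 * (card ?A + card V) + D2 * card V = D2 * (card ?A + 2 * card V)"
    by (simp add: algebra_simps)
  also have "\<dots> \<le> D2 * (3 * D1 * card V + 2 * card V)"
    using two_walks_from[of u] by (intro mult_left_mono add_mono) auto
  finally show ?thesis by (intro exI[of _ \<gamma>]) (simp add: algebra_simps)
qed

text \<open>If \<open>b\<close>, \<open>b'\<close> have few common neighbours, then \<open>(p', u, p, b)\<close> leaves few choices for the rest, and
  symmetrically for \<open>p\<close>, \<open>p'\<close>; otherwise both pairs are ends of the rare big two-walks.\<close>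

lemma colour_matched_pairs:
  "card {(u, p, b, m, p', b'). (u, p, b, m) \<in> three_walks \<and> (u, p', b', m) \<in> three_walks \<and> col p b = col p' b'}
    \<le> (1 + 4 * D1 + 4 * D1\<^sup>2) * card three_walks" (is "card ?Z \<le> _")
proof -
  let ?Z1 = "{(u, p, b, m, p', b') \<in> ?Z. p = p'}"
    and ?Z2 = "{(u, p, b, m, p', b') \<in> ?Z. p \<noteq> p' \<and> \<not> big b b'}"
    and ?Z3 = "{(u, p, b, m, p', b') \<in> ?Z. p \<noteq> p' \<and> \<not> big p p'}"
    and ?Z4 = "{(u, p, b, m, p', b') \<in> ?Z. big p p' \<and> big b b'}"
  have finZ: "finite ?Z"
    by (rule finite_subset[of _ "V \<times> V \<times> V \<times> V \<times> V \<times> V"])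
      (use adj_V adj_V' finite_V in \<open>auto simp: three_walks_def\<close>)
  have sub: "finite A" if "A \<subseteq> ?Z" for A using that finZ finite_subset by blast
  have finN: "finite {z. adj x z \<and> adj y z}" for x y
    by (rule finite_subset[OF _ finite_V]) (use adj_V' in auto)
  have det: "b = b'" if "adj p b" "adj p b'" "col p b = c" "col p b' = c" for p b b' c
    using proper[OF that(1,2)] that by simp
  have det': "p = p'" if "adj p b" "adj p' b" "col p b = c" "col p' b = c" for p p' b c
    using proper'[OF that(1,2)] that by simp
  \<comment> \<open>With \<open>p = p'\<close>, equal colours at \<open>p\<close> force
    \<open>b = b'\<close>.\<close>
  have "card ?Z1 \<le> card three_walks"
  proof (rule card_inj_on_le[of "\<lambda>(u, p, b, m, p', b'). (u, p, b, m)"])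
    show "inj_on (\<lambda>(u, p, b, m, p', b'). (u, p, b, m)) ?Z1"
      using det by (fastforce simp: inj_on_def three_walks_def)
  qed auto
  \<comment> \<open>The colour of \<open>p b\<close> determines \<open>b'\<close> at
    \<open>p'\<close>, and then \<open>m\<close> is a common neighbour of \<open>b\<close> and
    \<open>b'\<close>.\<close>
  moreover have "card ?Z2 \<le> 2 * D1 * card three_walks"
  proof (rule card_le_fibres[where f = "\<lambda>(u, p, b, m, p', b'). (p', u, p, b)", OF sub finite_three_walks])
    fix w assume "w \<in> three_walks"
    obtain p' u p b where w: "w = (p', u, p, b)" by (cases w) auto
    let ?A = "{z \<in> ?Z2. (\<lambda>(u, p, b, m, p', b'). (p', u, p, b)) z = w}"
    show "card ?A \<le> 2 * D1"
    proof (cases "?A = {}")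
      case True
      show ?thesis unfolding True by simp
    next
      case False
      then obtain m1 b1 where b1: "adj p' b1" "col p b = col p' b1" "p \<noteq> p'" "\<not> big b b1" "adj p b"
        by (auto simp: w three_walks_def)
      have "b \<noteq> b1" using det'[OF b1(5) _ b1(2), of p'] b1 by auto
      have "?A \<subseteq> (\<lambda>m. (u, p, b, m, p', b1)) ` {m. adj b m \<and> adj b1 m}"
      proof
        fix z assume "z \<in> ?A"
        then obtain m b' where z: "z = (u, p, b, m, p', b')" "adj b m" "adj b' m" "adj p' b'" "col p b = col p' b'"
          by (auto simp: w three_walks_def)
        have "b' = b1" using det[OF z(4) b1(1)] z(5) b1(2) by simp
        then show "z \<in> (\<lambda>m. (u, p, b, m, p', b1)) ` {m. adj b m \<and> adj b1 m}" using z by blast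
      qed
      then have "card ?A \<le> card {m. adj b m \<and> adj b1 m}" using finN surj_card_le by blast
      then show ?thesis using not_bigD[OF b1(4) \<open>b \<noteq> b1\<close>] by linarith
    qed
  qed (use adj_sym in \<open>auto simp: three_walks_def\<close>)
  moreover have "card ?Z3 \<le> 2 * D1 * card three_walks"
  proof (rule card_le_fibres[where f = "\<lambda>(u, p, b, m, p', b'). (p, b, m, b')", OF sub finite_three_walks])
    fix w assume "w \<in> three_walks"
    obtain p b m b' where w: "w = (p, b, m, b')" by (cases w) auto
    let ?A = "{z \<in> ?Z3. (\<lambda>(u, p, b, m, p', b'). (p, b, m, b')) z = w}"
    show "card ?A \<le> 2 * D1"
    proof (cases "?A = {}")
      case True
      show ?thesis unfolding True by simp
    next
      case False
      then obtain p1 where p1: "adj p1 b'" "col p b = col p1 b'" "p \<noteq> p1" "\<not> big p p1"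
        by (auto simp: w three_walks_def)
      have "?A \<subseteq> (\<lambda>u. (u, p, b, m, p1, b')) ` {u. adj p u \<and> adj p1 u}"
      proof
        fix z assume "z \<in> ?A"
        then obtain u p' where z: "z = (u, p, b, m, p', b')" "adj p u" "adj p' u" "adj p' b'" "col p b = col p' b'"
          using adj_sym by (auto simp: w three_walks_def)
        have "p' = p1" using det'[OF z(4) p1(1)] z(5) p1(2) by simp
        then show "z \<in> (\<lambda>u. (u, p, b, m, p1, b')) ` {u. adj p u \<and> adj p1 u}" using z by blast
      qed
      then have "card ?A \<le> card {u. adj p u \<and> adj p1 u}" using finN surj_card_le by blast
      then show ?thesis using not_bigD[OF p1(4) \<open>p \<noteq> p1\<close>] by linarith
    qed
  qed (use adj_sym in \<open>auto simp: three_walks_def\<close>)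
  \<comment> \<open>Over a middle edge \<open>p b\<close>, \<open>(u, p')\<close> is a big two-walk
    from \<open>p\<close> and \<open>(m, b')\<close> one from \<open>b\<close>; the bounds multiply
    to \<open>4 * D1\<^sup>2 * deg p * deg b\<close>.\<close>
  moreover have "card ?Z4 \<le> 4 * D1\<^sup>2 * card three_walks"
  proof -
    let ?T = "\<lambda>x. {(y, z). adj x y \<and> adj y z \<and> big x z}"
    have fin: "finite {(p, b). adj p b}"
      by (rule finite_subset[of _ "V \<times> V"]) (use adj_V adj_V' finite_V in auto)
    have "card ?Z4 \<le> card (SIGMA e:{(p, b). adj p b}. ?T (fst e) \<times> ?T (snd e))"
      by (rule card_inj_on_le[of "\<lambda>(u, p, b, m, p', b'). ((p, b), (u, p'), (m, b'))"])
        (use adj_sym fin in \<open>auto simp: inj_on_def three_walks_def\<close>)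
    also have "\<dots> = (\<Sum>e\<in>{(p, b). adj p b}. card (?T (fst e)) * card (?T (snd e)))"
      using fin by (simp add: card_cartesian_product)
    also have "\<dots> \<le> (\<Sum>e\<in>{(p, b). adj p b}. (2 * D1 * deg (fst e)) * (2 * D1 * deg (snd e)))"
      by (intro sum_mono mult_mono big_two_walks_from) auto
    also have "\<dots> = 4 * D1\<^sup>2 * card three_walks"
      unfolding card_three_walks_deg by (simp add: sum_distrib_left case_prod_beta power2_eq_square mult_ac)
    finally show ?thesis .
  qed
  moreover have "card ?Z \<le> card ?Z1 + (card ?Z2 + (card ?Z3 + card ?Z4))"
  proof -
    have "?Z = ?Z1 \<union> (?Z2 \<union> (?Z3 \<union> ?Z4))" by auto
    then have "card ?Z = card (?Z1 \<union> (?Z2 \<union> (?Z3 \<union> ?Z4)))" by (rule arg_cong)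
    also have "\<dots> \<le> card ?Z1 + (card ?Z2 + (card ?Z3 + card ?Z4))"
      by (intro order_trans[OF card_Un_le] add_mono order_refl)
    finally show ?thesis .
  qed
  ultimately show ?thesis by (simp add: algebra_simps)
qed

text \<open>Counted walks with the same ends share the middle colour \<open>\<gamma> u m\<close>, so
  Cauchy-Schwarz over the pairs of ends leads to \<open>colour_matched_pairs\<close>.\<close>

lemma popular_bound:
  "(card {(u, p, b, m) \<in> three_walks. col p b = \<gamma> u m})\<^sup>2 \<le> (1 + 4 * D1 + 4 * D1\<^sup>2) * (card V)\<^sup>2 * card three_walks"
proof -
  let ?R = "{(u, p, b, m) \<in> three_walks. col p b = \<gamma> u m}" and ?f = "\<lambda>(u, p, b, m). (u, m)"
  let ?Z = "{(u, p, b, m, p', b'). (u, p, b, m) \<in> three_walks \<and> (u, p', b', m) \<in> three_walks \<and> col p b = col p' b'}"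
  have finZ: "finite ?Z"
    by (rule finite_subset[of _ "V \<times> V \<times> V \<times> V \<times> V \<times> V"])
      (use adj_V adj_V' finite_V in \<open>auto simp: three_walks_def\<close>)
  have "(card ?R)\<^sup>2 \<le> card (V \<times> V) * card {(x, y) \<in> ?R \<times> ?R. ?f x = ?f y}"
    by (rule card_power2_le_pairs)
      (use finite_V adj_V adj_V' in \<open>auto simp: three_walks_def intro: finite_subset[OF _ finite_three_walks]\<close>)
  also have "card {(x, y) \<in> ?R \<times> ?R. ?f x = ?f y} \<le> card ?Z"
    by (rule card_inj_on_le[of "\<lambda>((u, p, b, m), (u', p', b', m')). (u, p, b, m, p', b')"])
      (use finZ in \<open>auto simp: inj_on_def\<close>)
  also have "\<dots> \<le> (1 + 4 * D1 + 4 * D1\<^sup>2) * card three_walks" by (rule colour_matched_pairs)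
  finally show ?thesis by (simp add: card_cartesian_product power2_eq_square algebra_simps)
qed

text \<open>The two summands belong to the two cases of \<open>three_walks_bound\<close>; 256 is the
  square of the 16 occurring there.\<close>

definition K3 :: nat where
  "K3 = 2 * ((4 + 4 * D1) * (3 * D1) + 8 * D2 * (3 * D1 + 2)) + 256 * (1 + 4 * D1 + 4 * D1\<^sup>2)"

lemma three_walks_bound:
  assumes k3: "3 \<le> k"
  shows "card three_walks \<le> K3 * (card V)\<^sup>2"
proof -
  let ?n = "card V" and ?G = "{(u, p, b, m). good u p b m}"
  define c where "c = 1 + 4 * D1 + 4 * D1\<^sup>2"
  define a where "a = (4 + 4 * D1) * (3 * D1) + 8 * D2 * (3 * D1 + 2)"
  have finG: "finite ?G" by (rule finite_subset[OF _ finite_three_walks]) (auto simp: good_def three_walks_def)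
  obtain S where S: "card ?G \<le> 8 * card {w \<in> ?G. (\<lambda>(u, p, b, m). col p b) w \<in> S \<and>
      (\<lambda>(u, p, b, m). col u p) w \<notin> S \<and> (\<lambda>(u, p, b, m). col b m) w \<notin> S}"
  proof (rule colour_split[OF finG, of "\<lambda>(u, p, b, m). col p b" "\<lambda>(u, p, b, m). col u p" "\<lambda>(u, p, b, m). col b m"])
    have "col p b \<noteq> col u p" "col p b \<noteq> col b m" if "good u p b m" for u p b m
      using that proper[of p b u] proper[of b p m] adj_sym col_sym[of p b] col_sym[of u p]
      by (auto simp: good_def)
    then show "(case w of (u, p, b, m) \<Rightarrow> col p b) \<noteq> (case w of (u, p, b, m) \<Rightarrow> col u p)"
      "(case w of (u, p, b, m) \<Rightarrow> col p b) \<noteq> (case w of (u, p, b, m) \<Rightarrow> col b m)" if "w \<in> ?G" for w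
      using that by auto
  qed
  let ?H = "\<lambda>u p b m. good u p b m \<and> col p b \<in> S \<and> col u p \<notin> S \<and> col b m \<notin> S"
  have "{w \<in> ?G. (\<lambda>(u, p, b, m). col p b) w \<in> S \<and>
      (\<lambda>(u, p, b, m). col u p) w \<notin> S \<and> (\<lambda>(u, p, b, m). col b m) w \<notin> S} = {(u, p, b, m). ?H u p b m}"
    by auto
  then have GS: "card ?G \<le> 8 * card {(u, p, b, m). ?H u p b m}" using S by simp
  have ex: "\<forall>u. \<exists>\<gamma>. card {(p, b, m). ?H u p b m \<and> col p b \<noteq> \<gamma> m} \<le> D2 * (3 * D1 + 2) * ?n"
    using unpopular_bound[OF k3, of _ S] by (simp add: conj_assoc)
  then obtain \<gamma> where \<gamma>: "\<And>u. card {(p, b, m). ?H u p b m \<and> col p b \<noteq> \<gamma> u m} \<le> D2 * (3 * D1 + 2) * ?n"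
    using choice[OF ex] by blast
  let ?R = "{(u, p, b, m) \<in> three_walks. col p b = \<gamma> u m}"
  let ?U = "SIGMA u:V. {(p, b, m). ?H u p b m \<and> col p b \<noteq> \<gamma> u m}"
  have finU: "finite {(p, b, m). ?H u p b m \<and> col p b \<noteq> \<gamma> u m}" for u
    by (rule finite_subset[of _ "V \<times> V \<times> V"]) (use adj_V adj_V' finite_V in \<open>auto simp: good_def\<close>)
  have finR: "finite ?R" by (rule finite_subset[OF _ finite_three_walks]) auto
  have "{(u, p, b, m). ?H u p b m} \<subseteq> ?U \<union> ?R" using adj_V by (auto simp: good_def three_walks_def)
  then have "card {(u, p, b, m). ?H u p b m} \<le> card (?U \<union> ?R)"
    using finU finR finite_V by (intro card_mono) auto
  also have "\<dots> \<le> card ?U + card ?R" by (rule card_Un_le)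
  also have "card ?U = (\<Sum>u\<in>V. card {(p, b, m). ?H u p b m \<and> col p b \<noteq> \<gamma> u m})"
    using finU finite_V by (intro card_SigmaI) auto
  also have "\<dots> \<le> (\<Sum>u\<in>V. D2 * (3 * D1 + 2) * ?n)" by (intro sum_mono \<gamma>)
  also have "\<dots> = D2 * (3 * D1 + 2) * ?n\<^sup>2" by (simp add: power2_eq_square mult_ac)
  finally have H: "card {(u, p, b, m). ?H u p b m} \<le> D2 * (3 * D1 + 2) * ?n\<^sup>2 + card ?R" by simp
  have "card three_walks \<le> card ?G + (4 + 4 * D1) * card two_walks" by (rule three_walks_good)
  also have "\<dots> \<le> 8 * (D2 * (3 * D1 + 2) * ?n\<^sup>2 + card ?R) + (4 + 4 * D1) * (3 * D1 * ?n\<^sup>2)"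
    by (intro add_mono mult_left_mono card_two_walks order_trans[OF GS] H) auto
  also have "\<dots> = a * ?n\<^sup>2 + 8 * card ?R" by (simp add: a_def algebra_simps)
  finally have W: "card three_walks \<le> a * ?n\<^sup>2 + 8 * card ?R" .
  have K3: "K3 = 2 * a + 256 * c" by (simp add: K3_def a_def c_def)
  show ?thesis
  proof (cases "card three_walks \<le> 2 * a * ?n\<^sup>2")
    case True
    then show ?thesis by (simp add: K3 algebra_simps)
  next
    case False
    \<comment> \<open>As \<open>a * ?n\<^sup>2\<close> is less than half of
      \<open>card three_walks\<close>, the term \<open>8 * card ?R\<close> accounts for the other
      half. Squaring then lets one factor \<open>card three_walks\<close> cancel.\<close>
    then have W16: "card three_walks \<le> 16 * card ?R" and pos: "0 < card three_walks" using W by auto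
    have "(card three_walks)\<^sup>2 \<le> (16 * card ?R)\<^sup>2" using W16 by (intro power_mono) auto
    also have "\<dots> = 256 * (card ?R)\<^sup>2" by (simp add: power_mult_distrib)
    also have "\<dots> \<le> 256 * (c * ?n\<^sup>2 * card three_walks)"
      using popular_bound[of \<gamma>] by (simp add: c_def)
    finally have "card three_walks * card three_walks \<le> (256 * c * ?n\<^sup>2) * card three_walks" by (simp add: power2_eq_square mult_ac)
    then have "card three_walks \<le> 256 * c * ?n\<^sup>2" using pos by simp
    then show ?thesis by (simp add: K3 algebra_simps)
  qed
qed

subsection \<open>Counting odd cycles\<close>

text \<open>The index counts edges, whereas that of \<open>cycles\<close> counts vertices.\<close>

definition walks :: "nat \<Rightarrow> 'a list set" where
  "walks j = {xs. length xs = Suc j \<and> set xs \<subseteq> V \<and> successively adj xs}"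

text \<open>A cycle is listed once for each start and direction, which does no harm in an upper
  bound.\<close>

definition cycles :: "nat \<Rightarrow> 'a list set" where
  "cycles m = {xs. length xs = m \<and> distinct xs \<and> successively adj (xs @ [hd xs])}"

lemma finite_walks [simp]: "finite (walks j)"
  by (rule finite_subset[OF _ finite_lists_length_eq[OF finite_V, of "Suc j"]]) (auto simp: walks_def)

text \<open>The two removed vertices form a two-walk from the new head, traversed backwards.\<close>

lemma walks_add_2: "card (walks (j + 2)) \<le> 3 * D1 * card V * card (walks j)"
proof (rule card_le_fibres[where f = "drop 2"])
  show "drop 2 ` walks (j + 2) \<subseteq> walks j"
  proof
    fix zs assume "zs \<in> drop 2 ` walks (j + 2)"
    then obtain xs where xs: "xs \<in> walks (j + 2)" "zs = drop 2 xs" by auto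
    then obtain a b where "xs = a # b # zs" by (cases xs; cases "tl xs") (auto simp: walks_def)
    then have "a # b # zs \<in> walks (j + 2)" using xs by simp
    then show "zs \<in> walks j" by (auto simp: walks_def successively_Cons)
  qed
  fix zs assume zs: "zs \<in> walks j"
  let ?A = "{xs \<in> walks (j + 2). drop 2 xs = zs}" and ?T = "{(p, y). adj (hd zs) p \<and> adj p y}"
  have "?A \<subseteq> (\<lambda>(p, y). y # p # zs) ` ?T"
  proof
    fix xs assume xs: "xs \<in> ?A"
    then obtain a b where ab: "xs = a # b # zs" by (cases xs; cases "tl xs") (auto simp: walks_def)
    moreover have "zs \<noteq> []" using zs by (auto simp: walks_def)
    ultimately show "xs \<in> (\<lambda>(p, y). y # p # zs) ` ?T"
      using xs adj_sym by (auto simp: walks_def successively_Cons intro!: image_eqI[where x = "(b, a)"])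
  qed
  moreover have "finite ?T" using finite_rel[where P = "\<lambda>_ _. True"] by simp
  ultimately have "card ?A \<le> card ?T" using surj_card_le by blast
  then show "card ?A \<le> 3 * D1 * card V" using two_walks_from order_trans by blast
qed auto

lemma walks_add_even: "card (walks (i + 2 * j)) \<le> (3 * D1 * card V) ^ j * card (walks i)"
proof (induction j)
  case (Suc j)
  have "card (walks (i + 2 * Suc j)) \<le> 3 * D1 * card V * card (walks (i + 2 * j))"
    using walks_add_2[of "i + 2 * j"] by simp
  also have "\<dots> \<le> 3 * D1 * card V * ((3 * D1 * card V) ^ j * card (walks i))"
    by (intro mult_left_mono Suc.IH) auto
  finally show ?case by (simp add: mult_ac)
qed simp

text \<open>Two edges with a common end form a two-walk, so Cauchy-Schwarz over that end gives
  \<open>O(n^(3/2))\<close> edges.\<close>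

lemma walks_1: "(card (walks 1))\<^sup>2 \<le> 3 * D1 * card V ^ 3"
proof -
  have w: "\<exists>u p. xs = [u, p] \<and> adj u p" if "xs \<in> walks 1" for xs
    using that by (cases xs; cases "tl xs") (auto simp: walks_def)
  let ?Z = "{(xs, ys) \<in> walks 1 \<times> walks 1. xs ! 1 = ys ! 1}"
  have "(card (walks 1))\<^sup>2 \<le> card V * card ?Z"
    by (rule card_power2_le_pairs) (use finite_V w adj_V' in \<open>force+\<close>)
  also have "card ?Z \<le> card two_walks"
  proof (rule card_inj_on_le[of "\<lambda>(xs, ys). (xs ! 0, xs ! 1, ys ! 0)"])
    show "inj_on (\<lambda>(xs, ys). (xs ! 0, xs ! 1, ys ! 0)) ?Z"
      by (rule inj_onI) (auto dest!: w[unfolded One_nat_def])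
    show "(\<lambda>(xs, ys). (xs ! 0, xs ! 1, ys ! 0)) ` ?Z \<subseteq> two_walks"
      using adj_sym by (auto simp: two_walks_def dest!: w[unfolded One_nat_def])
  qed simp
  also have "\<dots> \<le> 3 * D1 * (card V)\<^sup>2" by (rule card_two_walks)
  finally show ?thesis by (simp add: power2_eq_square power3_eq_cube mult_ac)
qed

lemma walks_3: "card (walks 3) \<le> card three_walks"
proof (rule card_inj_on_le[of "\<lambda>xs. (xs ! 0, xs ! 1, xs ! 2, xs ! 3)"])
  have w: "\<exists>a b c d. xs = [a, b, c, d] \<and> adj a b \<and> adj b c \<and> adj c d" if "xs \<in> walks 3" for xs
    using that by (auto simp: walks_def length_Suc_conv numeral_eq_Suc)
  show "inj_on (\<lambda>xs. (xs ! 0, xs ! 1, xs ! 2, xs ! 3)) (walks 3)"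
    by (rule inj_onI) (auto dest!: w)
  show "(\<lambda>xs. (xs ! 0, xs ! 1, xs ! 2, xs ! 3)) ` walks 3 \<subseteq> three_walks"
    by (auto simp: three_walks_def dest!: w)
qed simp

lemma walks_Suc: "(\<Sum>zs\<in>walks j. deg (last zs)) \<le> card (walks (Suc j))"
proof -
  have "(\<Sum>zs\<in>walks j. deg (last zs)) = card (SIGMA zs:walks j. nb (last zs))" by simp
  also have "\<dots> \<le> card (walks (Suc j))"
    by (rule card_inj_on_le[of "\<lambda>(zs, a). zs @ [a]", OF _ _ finite_walks])
      (use adj_V' in \<open>auto simp: inj_on_def walks_def nb_def successively_append_iff\<close>)
  finally show ?thesis .
qed

text \<open>Write a cycle as \<open>a # b # zs\<close>. If \<open>b\<close> and
  \<open>last zs\<close> have few common neighbours, drop \<open>a\<close>: the walk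
  \<open>b # zs\<close> leaves at most \<open>2 * D1\<close> choices for it. Otherwise
  \<open>(a, b)\<close> is a big two-walk from \<open>last zs\<close>; there are
  \<open>O(deg (last zs))\<close> of these, comparable to the one-step extensions of
  \<open>zs\<close>.\<close>

lemma cycles_le_walks:
  assumes "l \<ge> 2"
  shows "card (cycles (2 * l + 1)) \<le> 4 * D1 * card (walks (2 * l - 1))"
proof -
  let ?C = "cycles (Suc (2 * l))"
  have c: "\<exists>a b zs. xs = a # b # zs \<and> length zs = 2 * l - 1 \<and> zs \<noteq> [] \<and> adj a b \<and> adj b (hd zs) \<and>
      adj (last zs) a \<and> successively adj zs \<and> b \<noteq> last zs \<and> set zs \<subseteq> V \<and> {a, b} \<subseteq> V"
    if "xs \<in> ?C" for xs
  proof -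
    have x: "successively adj (xs @ [hd xs])" "distinct xs" "length xs = 2 * l + 1"
      using that by (auto simp: cycles_def)
    obtain a b zs where xs: "xs = a # b # zs" "zs \<noteq> []"
      using x assms by (cases xs; cases "tl xs"; cases "tl (tl xs)") auto
    have V: "set ys \<subseteq> V" if "successively adj (ys @ [z])" for ys z
      using that by (induction ys) (use adj_V in \<open>auto simp: successively_Cons hd_append split: if_splits\<close>)
    have "adj a b" "adj b (hd zs)" "adj (last zs) a" "successively adj zs"
      using x(1) xs by (simp_all add: successively_Cons successively_append_iff)
    moreover have "b \<noteq> last zs" using x(2) xs last_in_set by fastforce
    moreover have "set zs \<subseteq> V" "{a, b} \<subseteq> V" using V[OF x(1)] xs by auto
    ultimately show ?thesis using xs x(3) by auto
  qed
  have finC: "finite ?C"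
  proof (rule finite_subset[OF _ finite_lists_length_eq[OF finite_V, of "2 * l + 1"]])
    show "?C \<subseteq> {xs. set xs \<subseteq> V \<and> length xs = 2 * l + 1}"
      using c by (fastforce simp: cycles_def)
  qed
  let ?S = "{xs \<in> ?C. \<not> big (xs ! 1) (last xs)}" and ?B = "{xs \<in> ?C. big (xs ! 1) (last xs)}"
  have "card ?S \<le> 2 * D1 * card (walks (2 * l - 1))"
  proof (rule card_le_fibres[where f = tl])
    show "tl ` ?S \<subseteq> walks (2 * l - 1)"
      using assms by (auto simp: walks_def successively_Cons dest!: c)
    fix ys assume "ys \<in> walks (2 * l - 1)"
    let ?A = "{xs \<in> ?S. tl xs = ys}"
    show "card ?A \<le> 2 * D1"
    proof (cases "?A = {}")
      case True
      show ?thesis unfolding True by simp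
    next
      case False
      then have nb: "\<not> big (hd ys) (last ys)" "hd ys \<noteq> last ys" by (auto dest!: c)
      have "?A \<subseteq> (\<lambda>a. a # ys) ` {a. adj (hd ys) a \<and> adj (last ys) a}"
        using adj_sym by (auto dest!: c)
      moreover have "finite {a. adj (hd ys) a \<and> adj (last ys) a}"
        by (rule finite_subset[OF _ finite_V]) (use adj_V' in auto)
      ultimately have "card ?A \<le> card {a. adj (hd ys) a \<and> adj (last ys) a}" using surj_card_le by blast
      then show ?thesis using not_bigD[OF nb] by linarith
    qed
  qed (use finC in auto)
  moreover have "card ?B \<le> 2 * D1 * card (walks (2 * l - 1))"
  proof -
    let ?T = "\<lambda>zs. {(a, b). adj (last zs) a \<and> adj a b \<and> big (last zs) b}"
    have "card ?B \<le> card (SIGMA zs:walks (2 * l - 2). ?T zs)"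
    proof (rule card_inj_on_le[of "\<lambda>xs. (drop 2 xs, (hd xs, xs ! 1))"])
      show "inj_on (\<lambda>xs. (drop 2 xs, (hd xs, xs ! 1))) ?B"
        by (rule inj_onI) (auto dest!: c)
      show "(\<lambda>xs. (drop 2 xs, (hd xs, xs ! 1))) ` ?B \<subseteq> (SIGMA zs:walks (2 * l - 2). ?T zs)"
        using assms big_sym by (auto simp: walks_def dest!: c)
      show "finite (SIGMA zs:walks (2 * l - 2). ?T zs)" by (intro finite_SigmaI finite_rel finite_walks)
    qed
    also have "\<dots> = (\<Sum>zs\<in>walks (2 * l - 2). card (?T zs))" by (intro card_SigmaI ballI finite_rel finite_walks)
    also have "\<dots> \<le> (\<Sum>zs\<in>walks (2 * l - 2). 2 * D1 * deg (last zs))"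
      by (intro sum_mono big_two_walks_from)
    also have "\<dots> \<le> 2 * D1 * card (walks (Suc (2 * l - 2)))"
      unfolding sum_distrib_left[symmetric] by (intro mult_left_mono walks_Suc) auto
    also have "Suc (2 * l - 2) = 2 * l - 1" using assms by simp
    finally show ?thesis .
  qed
  moreover have "card ?C \<le> card ?S + card ?B"
  proof -
    have "?C = ?S \<union> ?B" by auto
    then have "card ?C = card (?S \<union> ?B)" by (rule arg_cong)
    then show ?thesis using card_Un_le[of ?S ?B] by linarith
  qed
  ultimately show ?thesis by simp
qed

lemma cycles_bound_ge_3:
  assumes "l \<ge> 2" "k \<ge> 3"
  shows "card (cycles (2 * l + 1)) \<le> 4 * D1 * (3 * D1) ^ (l - 2) * K3 * card V ^ l"
proof -
  \<comment> \<open>A walk of length three prolonged by \<open>l - 2\<close> two-walks, each at a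
    cost of \<open>O(n)\<close>.\<close>
  have "2 * l - 1 = 3 + 2 * (l - 2)" using assms by simp
  then have "card (cycles (2 * l + 1)) \<le> 4 * D1 * card (walks (3 + 2 * (l - 2)))"
    using cycles_le_walks[OF assms(1)] by simp
  also have "\<dots> \<le> 4 * D1 * ((3 * D1 * card V) ^ (l - 2) * (K3 * (card V)\<^sup>2))"
    by (intro mult_left_mono order_trans[OF walks_add_even] order_trans[OF walks_3] three_walks_bound assms) auto
  also have "\<dots> = 4 * D1 * (3 * D1) ^ (l - 2) * K3 * (card V ^ (l - 2) * (card V)\<^sup>2)"
    by (simp add: power_mult_distrib mult_ac)
  also have "card V ^ (l - 2) * (card V)\<^sup>2 = card V ^ l"
    using assms by (metis le_add_diff_inverse2 power_add)
  finally show ?thesis .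
qed

text \<open>Here an edge is prolonged by \<open>l - 1\<close> two-walks. Squaring turns the exponent
  \<open>l + 1/2\<close> into the integer \<open>2 * l + 1\<close>.\<close>

lemma cycles_bound_ge_2:
  assumes "l \<ge> 2"
  shows "(card (cycles (2 * l + 1)))\<^sup>2 \<le> (4 * D1 * (3 * D1) ^ (l - 1))\<^sup>2 * (3 * D1) * card V ^ (2 * l + 1)"
proof -
  let ?n = "card V"
  have "2 * l - 1 = 1 + 2 * (l - 1)" using assms by simp
  then have "card (cycles (2 * l + 1)) \<le> 4 * D1 * card (walks (1 + 2 * (l - 1)))"
    using cycles_le_walks[OF assms(1)] by simp
  also have "\<dots> \<le> 4 * D1 * ((3 * D1 * ?n) ^ (l - 1) * card (walks 1))"
    by (intro mult_left_mono walks_add_even) auto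
  finally have "(card (cycles (2 * l + 1)))\<^sup>2 \<le> (4 * D1 * ((3 * D1 * ?n) ^ (l - 1) * card (walks 1)))\<^sup>2"
    by (intro power_mono) auto
  also have "\<dots> = (4 * D1 * (3 * D1) ^ (l - 1))\<^sup>2 * ?n ^ (2 * (l - 1)) * (card (walks 1))\<^sup>2"
    by (simp add: power_mult_distrib power_mult[symmetric] mult_ac)
  also have "\<dots> \<le> (4 * D1 * (3 * D1) ^ (l - 1))\<^sup>2 * ?n ^ (2 * (l - 1)) * (3 * D1 * ?n ^ 3)"
    by (intro mult_left_mono walks_1) auto
  also have "\<dots> = (4 * D1 * (3 * D1) ^ (l - 1))\<^sup>2 * (3 * D1) * ?n ^ (2 * (l - 1) + 3)"
    by (simp only: power_add mult_ac)
  also have "2 * (l - 1) + 3 = 2 * l + 1" using assms by simp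
  finally show ?thesis .
qed

end

subsection \<open>Cycles as lists\<close>

definition cyc :: "'a list \<Rightarrow> 'a ugraph" where
  "cyc xs = (set xs, (\<lambda>i. {xs ! i, xs ! (Suc i mod length xs)}) ` {..<length xs})"

text \<open>Links closed lists \<open>xs @ [hd xs]\<close> with the cyclic indices of
  \<open>cycle_graph\<close>.\<close>

lemma nth_closed:
  assumes "i < length xs"
  shows "(xs @ [hd xs]) ! i = xs ! i" "(xs @ [hd xs]) ! Suc i = xs ! (Suc i mod length xs)"
proof -
  show "(xs @ [hd xs]) ! i = xs ! i" using assms by (simp add: nth_append)
  show "(xs @ [hd xs]) ! Suc i = xs ! (Suc i mod length xs)"
  proof (cases "Suc i = length xs")
    case True
    have "xs \<noteq> []" using assms by auto
    then show ?thesis unfolding True by (simp add: hd_conv_nth)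
  next
    case False
    then show ?thesis using assms by (simp add: nth_append)
  qed
qed

lemma successively_closed:
  "successively P (xs @ [hd xs]) \<longleftrightarrow> (\<forall>i<length xs. P (xs ! i) (xs ! (Suc i mod length xs)))"
  unfolding successively_conv_nth using nth_closed[of _ xs] by (simp del: nth_append_length)

lemma cols_nth: "cols c xs = map (\<lambda>i. c (xs ! i) (xs ! Suc i)) [0..<length xs - 1]"
  by (induction c xs rule: cols.induct) (auto simp: map_upt_Suc simp del: upt_Suc)

lemma cols_closed:
  "cols c (xs @ [hd xs]) = map (\<lambda>i. c (xs ! i) (xs ! (Suc i mod length xs))) [0..<length xs]"
  unfolding cols_nth using nth_closed[of _ xs] by (intro map_cong) auto

lemma edges_cycle_graph: "edges (cycle_graph m) = (\<lambda>i. {i, Suc i mod m}) ` {..<m}"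
  by (auto simp: cycle_graph_def)

text \<open>An isomorphism \<open>f\<close> from the standard cycle is recorded as the list
  \<open>map f [0..<m]\<close>; conversely \<open>nth xs\<close> is such an isomorphism.\<close>

lemma copies_cycle_graph:
  assumes G: "simple_graph G" and m: "m \<ge> 2"
  shows "copies (cycle_graph m) G =
    cyc ` {xs. length xs = m \<and> distinct xs \<and> successively (\<lambda>x y. {x, y} \<in> edges G) (xs @ [hd xs])}"
    (is "_ = cyc ` ?Z")
proof (intro equalityI subsetI)
  fix S assume "S \<in> copies (cycle_graph m) G"
  then obtain f where S: "edges S \<subseteq> edges G" and f: "bij_betw f {..<m} (verts S)"
    and e: "edges S = (\<lambda>e. f ` e) ` edges (cycle_graph m)"
    by (auto simp: copies_def subgraph_def graph_iso_def cycle_graph_def)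
  define xs where "xs = map f [0..<m]"
  have len: "length xs = m" by (simp add: xs_def)
  have nth: "xs ! i = f i" "xs ! (Suc i mod m) = f (Suc i mod m)" if "i < m" for i
    using that by (auto simp: xs_def)
  have ES: "edges S = (\<lambda>i. {xs ! i, xs ! (Suc i mod length xs)}) ` {..<length xs}"
  proof -
    have "edges S = (\<lambda>i. f ` {i, Suc i mod m}) ` {..<m}"
      unfolding e edges_cycle_graph by (simp only: image_image)
    also have "\<dots> = (\<lambda>i. {xs ! i, xs ! (Suc i mod length xs)}) ` {..<length xs}"
      unfolding len by (intro image_cong refl) (simp add: nth)
    finally show ?thesis .
  qed
  have "set xs = verts S"
    using f by (auto simp: xs_def bij_betw_def atLeast0LessThan)
  then have "S = cyc xs" using ES by (simp add: cyc_def prod_eq_iff)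
  moreover have "xs \<in> ?Z"
    using f S ES len
    by (auto simp: successively_closed xs_def distinct_map bij_betw_def atLeast0LessThan)
  ultimately show "S \<in> cyc ` ?Z" by blast
next
  fix S assume "S \<in> cyc ` ?Z"
  then obtain xs where xs: "length xs = m" "distinct xs" "S = cyc xs"
    and adj: "\<And>i. i < m \<Longrightarrow> {xs ! i, xs ! (Suc i mod m)} \<in> edges G"
    by (auto simp: successively_closed)
  have ES: "edges S \<subseteq> edges G" using adj xs(1) by (auto simp: xs(3) cyc_def)
  have VS: "verts S \<subseteq> verts G"
    using adj G xs(1) by (force simp: xs(3) cyc_def in_set_conv_nth simple_graph_def)
  have "0 < length xs" using xs(1) m by simp
  then have "\<And>e. e \<in> edges S \<Longrightarrow> e \<subseteq> verts S"
    using mod_less_divisor by (auto simp: xs(3) cyc_def intro!: nth_mem)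
  then have "subgraph S G"
    using ES VS G by (auto simp: subgraph_def simple_graph_def intro: finite_subset)
  moreover have "graph_iso (cycle_graph m) S"
    unfolding graph_iso_def
  proof (intro exI[of _ "nth xs"] conjI)
    show "bij_betw ((!) xs) (verts (cycle_graph m)) (verts S)"
      using xs by (auto simp: cycle_graph_def cyc_def intro!: bij_betw_nth)
    show "edges S = (\<lambda>e. (!) xs ` e) ` edges (cycle_graph m)"
      unfolding edges_cycle_graph xs(3) cyc_def xs(1) snd_conv image_image by simp
  qed
  ultimately show "S \<in> copies (cycle_graph m) G" by (simp add: copies_def)
qed

lemma edges_cycle_graph_nonempty: "m > 0 \<Longrightarrow> edges (cycle_graph m) \<noteq> {}"
  by (auto simp: cycle_graph_def)

lemma ex_rainbow_attained:
  assumes "m > 0"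
  obtains G :: "nat ugraph" and c :: "nat set \<Rightarrow> nat" where
    "simple_graph G" "card (verts G) = n" "proper_edge_colouring G c"
    "rainbow_free (cycle_graph m) G c" "ex_rainbow n H (cycle_graph m) = card (copies H G)"
proof -
  have "ex_rainbow n H (cycle_graph m) \<in> rainbow_copy_counts n H (cycle_graph m)"
    unfolding ex_rainbow_def
    by (intro Max_in finite_rainbow_copy_counts rainbow_copy_counts_nonempty edges_cycle_graph_nonempty assms)
  then show ?thesis using that by (auto simp: rainbow_copy_counts_def)
qed

lemma rainbow_cycle_free_graph:
  assumes G: "simple_graph G" and c: "proper_edge_colouring G c"
    and free: "rainbow_free (cycle_graph (2 * k)) G c" and k: "k \<ge> 2"
  shows "rainbow_cycle_free (verts G) (\<lambda>x y. {x, y} \<in> edges G) (\<lambda>x y. c {x, y}) k"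
proof
  show "finite (verts G)" using G by (simp add: simple_graph_def)
  show "x \<in> verts G" if "{x, y} \<in> edges G" for x y
    using G that by (auto simp: simple_graph_def)
  show "{x, x} \<notin> edges G" for x using G by (force simp: simple_graph_def)
  show "y = z" if "{x, y} \<in> edges G" "{x, z} \<in> edges G" "c {x, y} = c {x, z}" for x y z
  proof (rule ccontr)
    assume "y \<noteq> z"
    then have "{x, y} \<noteq> {x, z}" by (auto simp: doubleton_eq_iff)
    then show False
      using c[unfolded proper_edge_colouring_def, rule_format, OF that(1,2)] that(3) by simp
  qed
  show False if xs: "length xs = 2 * k" "distinct xs"
    "successively (\<lambda>x y. {x, y} \<in> edges G) (xs @ [hd xs])"
    "distinct (cols (\<lambda>x y. c {x, y}) (xs @ [hd xs]))" for xs
  proof -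
    have "cyc xs \<in> copies (cycle_graph (2 * k)) G"
      using xs k by (subst copies_cycle_graph[OF G]) auto
    moreover have "rainbow c (cyc xs)"
      using xs(4) unfolding cols_closed rainbow_def cyc_def distinct_map snd_conv
      by (intro inj_on_imageI) (simp add: comp_def atLeast0LessThan)
    ultimately show False using free by (auto simp: rainbow_free_def)
  qed
qed (use k in \<open>auto simp: insert_commute\<close>)

lemma copies_le_cycles:
  assumes "rainbow_cycle_free (verts G) (\<lambda>x y. {x, y} \<in> edges G) (\<lambda>x y. c {x, y}) k"
    and "simple_graph G" "m \<ge> 2"
  shows "card (copies (cycle_graph m) G) \<le> card (rainbow_cycle_free.cycles (\<lambda>x y. {x, y} \<in> edges G) m)"
proof -
  interpret rainbow_cycle_free "verts G" "\<lambda>x y. {x, y} \<in> edges G" "\<lambda>x y. c {x, y}" k by fact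
  have "cycles m \<subseteq> {xs. set xs \<subseteq> verts G \<and> length xs = m}"
    using adj_V by (force simp: cycles_def successively_closed in_set_conv_nth)
  then have "finite (cycles m)"
    by (rule finite_subset[OF _ finite_lists_length_eq[OF finite_V]])
  then show ?thesis
    unfolding copies_cycle_graph[OF assms(2,3)] cycles_def[symmetric] by (rule card_image_le)
qed

text \<open>The constants of the locale depend on \<open>k\<close> alone, so one \<open>C\<close>
  serves all \<open>n\<close> and all extremal graphs.\<close>

lemma ex_rainbow_upper_ge_3:
  assumes "k \<ge> 3" "l \<ge> 2"
  obtains C where "\<And>n. ex_rainbow n (cycle_graph (2 * l + 1)) (cycle_graph (2 * k)) \<le> C * n ^ l"
proof (rule that)
  fix n
  obtain G :: "nat ugraph" and c :: "nat set \<Rightarrow> nat" where G: "simple_graph G" "card (verts G) = n"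
    "proper_edge_colouring G c" "rainbow_free (cycle_graph (2 * k)) G c"
    "ex_rainbow n (cycle_graph (2 * l + 1)) (cycle_graph (2 * k)) = card (copies (cycle_graph (2 * l + 1)) G)"
    using ex_rainbow_attained[of "2 * k" n "cycle_graph (2 * l + 1)"] assms by auto
  have R: "rainbow_cycle_free (verts G) (\<lambda>x y. {x, y} \<in> edges G) (\<lambda>x y. c {x, y}) k"
    by (rule rainbow_cycle_free_graph[OF G(1,3,4)]) (use assms in simp)
  show "ex_rainbow n (cycle_graph (2 * l + 1)) (cycle_graph (2 * k)) \<le>
    4 * rainbow_cycle_free.D1 k * (3 * rainbow_cycle_free.D1 k) ^ (l - 2) * rainbow_cycle_free.K3 k * n ^ l"
    using copies_le_cycles[OF R G(1), of "2 * l + 1"] rainbow_cycle_free.cycles_bound_ge_3[OF R assms(2,1)]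
      assms(2) unfolding G(2,5) by simp
qed

lemma ex_rainbow_upper_ge_2:
  assumes "k \<ge> 2" "l \<ge> 2"
  obtains C where "\<And>n. (ex_rainbow n (cycle_graph (2 * l + 1)) (cycle_graph (2 * k)))\<^sup>2 \<le> C * n ^ (2 * l + 1)"
proof (rule that)
  fix n
  obtain G :: "nat ugraph" and c :: "nat set \<Rightarrow> nat" where G: "simple_graph G" "card (verts G) = n"
    "proper_edge_colouring G c" "rainbow_free (cycle_graph (2 * k)) G c"
    "ex_rainbow n (cycle_graph (2 * l + 1)) (cycle_graph (2 * k)) = card (copies (cycle_graph (2 * l + 1)) G)"
    using ex_rainbow_attained[of "2 * k" n "cycle_graph (2 * l + 1)"] assms by auto
  have R: "rainbow_cycle_free (verts G) (\<lambda>x y. {x, y} \<in> edges G) (\<lambda>x y. c {x, y}) k"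
    by (rule rainbow_cycle_free_graph[OF G(1,3,4)]) (use assms in simp)
  have "(ex_rainbow n (cycle_graph (2 * l + 1)) (cycle_graph (2 * k)))\<^sup>2 \<le>
      (card (rainbow_cycle_free.cycles (\<lambda>x y. {x, y} \<in> edges G) (2 * l + 1)))\<^sup>2"
    unfolding G(5) using copies_le_cycles[OF R G(1)] assms by (intro power_mono) auto
  also have "\<dots> \<le> (4 * rainbow_cycle_free.D1 k * (3 * rainbow_cycle_free.D1 k) ^ (l - 1))\<^sup>2 *
      (3 * rainbow_cycle_free.D1 k) * n ^ (2 * l + 1)"
    using rainbow_cycle_free.cycles_bound_ge_2[OF R assms(2)] unfolding G(2) .
  finally show "(ex_rainbow n (cycle_graph (2 * l + 1)) (cycle_graph (2 * k)))\<^sup>2 \<le>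
      (4 * rainbow_cycle_free.D1 k * (3 * rainbow_cycle_free.D1 k) ^ (l - 1))\<^sup>2 *
      (3 * rainbow_cycle_free.D1 k) * n ^ (2 * l + 1)" .
qed

section \<open>Lower bounds from graphs without \<open>C_2k\<close>\<close>

text \<open>The graph is carried to \<open>nat\<close> by \<open>h\<close> and padded with isolated
  vertices to exactly \<open>n\<close>. With no cycle of length \<open>2 * k\<close> at all, an
  injective colouring will do. At most \<open>m ^ m\<close> lists of length \<open>m\<close> use
  only the vertices of a given copy, hence the factor.\<close>

lemma ex_rainbow_lower:
  fixes adj :: "'b \<Rightarrow> 'b \<Rightarrow> bool"
  assumes V: "finite V" "card V \<le> n" and adj_V: "\<And>x y. adj x y \<Longrightarrow> x \<in> V"
    and sym: "\<And>x y. adj x y \<Longrightarrow> adj y x" and irrefl: "\<And>x. \<not> adj x x"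
    and m: "m \<ge> 2" and k: "k > 0"
    and free: "\<And>xs. length xs = 2 * k \<Longrightarrow> distinct xs \<Longrightarrow> successively adj (xs @ [hd xs]) \<Longrightarrow> False"
    and Z: "\<And>xs. xs \<in> Z \<Longrightarrow> length xs = m \<and> distinct xs \<and> successively adj (xs @ [hd xs])"
  shows "card Z \<le> m ^ m * ex_rainbow n (cycle_graph m) (cycle_graph (2 * k))"
proof -
  obtain h where h: "inj_on h V" "h ` V \<subseteq> {..<n}"
    using card_le_inj[OF V(1), of "{..<n}"] V(2) by auto
  define g where "g = inv_into V h"
  have gh: "g (h x) = x" if "x \<in> V" for x using h(1) that by (simp add: g_def)
  define G :: "nat ugraph" where "G = ({..<n}, {{h x, h y} | x y. adj x y})"
  have hadj: "h x \<noteq> h y" "h x < n" "h y < n" if "adj x y" for x y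
  proof -
    have "x \<in> V" "y \<in> V" "x \<noteq> y" using that adj_V sym irrefl by blast+
    then show "h x \<noteq> h y" "h x < n" "h y < n" using h by (auto simp: inj_on_def)
  qed
  have G: "simple_graph G"
    using hadj by (auto simp: simple_graph_def G_def)
  have adjG: "adj (g a) (g b)" "a \<in> h ` V" if ab: "{a, b} \<in> edges G" for a b
  proof -
    obtain x y where xy: "{a, b} = {h x, h y}" "adj x y" using ab by (auto simp: G_def)
    then have "adj y x" "x \<in> V" "y \<in> V" using adj_V sym by blast+
    with xy show "adj (g a) (g b)" "a \<in> h ` V"
      using gh by (auto simp: doubleton_eq_iff)
  qed
  have "edges G \<subseteq> Pow {..<n}" using hadj by (auto simp: G_def)
  then have "finite (edges G)" by (rule finite_subset) simp
  then obtain c :: "nat set \<Rightarrow> nat" where c: "inj_on c (edges G)"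
    using finite_imp_inj_to_nat_seg by blast
  have "proper_edge_colouring G c" using c by (auto simp: proper_edge_colouring_def inj_on_def)
  moreover have "copies (cycle_graph (2 * k)) G = {}"
  proof -
    have False if xs: "length xs = 2 * k" "distinct xs" "successively (\<lambda>x y. {x, y} \<in> edges G) (xs @ [hd xs])" for xs
    proof (rule free[of "map g xs"])
      have "set xs \<subseteq> h ` V" using xs(3) adjG(2) by (force simp: successively_closed in_set_conv_nth)
      then show "distinct (map g xs)"
        using xs(2) by (auto simp: distinct_map g_def intro: inj_on_inv_into inj_on_subset)
      show "successively adj (map g xs @ [hd (map g xs)])"
        using xs(1,3) adjG(1) k by (auto simp: successively_closed)
    qed (use xs in auto)
    then show ?thesis using copies_cycle_graph[OF G, of "2 * k"] k by auto
  qed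
  then have "rainbow_free (cycle_graph (2 * k)) G c" by (simp add: rainbow_free_def)
  moreover have "card (verts G) = n" by (simp add: G_def)
  ultimately have "card (copies (cycle_graph m) G) \<in> rainbow_copy_counts n (cycle_graph m) (cycle_graph (2 * k))"
    using G unfolding rainbow_copy_counts_def by blast
  then have le: "card (copies (cycle_graph m) G) \<le> ex_rainbow n (cycle_graph m) (cycle_graph (2 * k))"
    unfolding ex_rainbow_def by (intro Max_ge finite_rainbow_copy_counts)
  have ZV: "set xs \<subseteq> V" if "xs \<in> Z" for xs
    using Z[OF that] adj_V by (force simp: successively_closed in_set_conv_nth)
  have finZ: "finite Z"
    by (rule finite_subset[OF _ finite_lists_length_eq[OF V(1), of m]]) (use ZV Z in auto)
  have cyc: "cyc (map h xs) \<in> copies (cycle_graph m) G" if "xs \<in> Z" for xs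
  proof -
    have "successively (\<lambda>x y. {x, y} \<in> edges G) (map h xs @ [hd (map h xs)])"
      using Z[OF that] m by (auto simp: successively_closed G_def)
    moreover have "distinct (map h xs)"
      using Z[OF that] ZV[OF that] h(1) by (auto simp: distinct_map intro: inj_on_subset)
    ultimately show ?thesis
      using Z[OF that] by (subst copies_cycle_graph[OF G m]) auto
  qed
  have "finite (copies (cycle_graph m) G)"
  proof -
    have "copies (cycle_graph m) G \<subseteq> Pow {..<n} \<times> Pow (edges G)"
      by (auto simp: copies_def subgraph_def G_def)
    then show ?thesis by (rule finite_subset) (use \<open>finite (edges G)\<close> in auto)
  qed
  then have "card Z \<le> m ^ m * card (copies (cycle_graph m) G)"
  proof (rule card_le_fibres[OF finZ, where f = "\<lambda>xs. cyc (map h xs)"])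
    fix S assume S: "S \<in> copies (cycle_graph m) G"
    then have cS: "card (verts S) = m" "finite (verts S)"
      by (auto simp: copies_def graph_iso_def cycle_graph_def subgraph_def simple_graph_def dest!: bij_betw_same_card)
    have "{xs \<in> Z. cyc (map h xs) = S} \<subseteq> {xs. set xs \<subseteq> g ` verts S \<and> length xs = m}"
    proof safe
      fix xs x assume xs: "xs \<in> Z" "S = cyc (map h xs)" "x \<in> set xs"
      then have "x \<in> V" using ZV by blast
      then have "x = g (h x)" by (simp add: gh)
      moreover have "h x \<in> verts (cyc (map h xs))" using xs(3) by (auto simp: cyc_def)
      ultimately show "x \<in> g ` verts (cyc (map h xs))" by blast
    qed (use Z in auto)
    then have "card {xs \<in> Z. cyc (map h xs) = S} \<le> card {xs. set xs \<subseteq> g ` verts S \<and> length xs = m}"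
      using cS by (intro card_mono finite_lists_length_eq) auto
    also have "\<dots> = card (g ` verts S) ^ m" using cS by (intro card_lists_length_eq) auto
    also have "\<dots> \<le> m ^ m" using cS card_image_le[of "verts S" g] by (intro power_mono) auto
    finally show "card {xs \<in> Z. cyc (map h xs) = S} \<le> m ^ m" .
  qed (use cyc in auto)
  also have "\<dots> \<le> m ^ m * ex_rainbow n (cycle_graph m) (cycle_graph (2 * k))"
    by (intro mult_left_mono le) auto
  finally show ?thesis .
qed

subsection \<open>Extremal graphs for k at least 3\<close>

text \<open>Hubs are \<open>(2 i, 0)\<close> for \<open>i \<le> l\<close>; the \<open>s\<close> vertices \<open>(2 i + 1, j)\<close> are the common neighbours of
  the hubs \<open>(2 i, 0)\<close> and \<open>(2 i + 2, 0)\<close>, and the first and the last hub are adjacent.\<close>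

definition chain_verts :: "nat \<Rightarrow> nat \<Rightarrow> (nat \<times> nat) set" where
  "chain_verts l s = {(a, i). a \<le> 2 * l \<and> (if even a then i = 0 else i < s)}"

definition chain_adj :: "nat \<Rightarrow> nat \<Rightarrow> nat \<times> nat \<Rightarrow> nat \<times> nat \<Rightarrow> bool" where
  "chain_adj l s x y \<longleftrightarrow> x \<in> chain_verts l s \<and> y \<in> chain_verts l s \<and>
     (fst x = Suc (fst y) \<or> fst y = Suc (fst x) \<or> {fst x, fst y} = {0, 2 * l})"

lemma chain_verts_subset: "chain_verts l s \<subseteq> {..2 * l} \<times> {..s}"
  by (auto simp: chain_verts_def split: if_splits)

lemma card_chain_verts: "card (chain_verts l s) \<le> (2 * l + 1) * (s + 1)"
proof -
  have "card (chain_verts l s) \<le> card ({..2 * l} \<times> {..s})"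
    by (intro card_mono chain_verts_subset) auto
  then show ?thesis by (simp add: card_cartesian_product)
qed

text \<open>Only the edge between the first and the last hub preserves the parity of
  \<open>fst\<close>, so an even cycle cannot use it, and \<open>fst\<close> changes by 1 at each
  step. At a vertex of maximal level \<open>M\<close>, odd \<open>M\<close> makes both cycle
  neighbours the hub at \<open>M - 1\<close>. For even \<open>M\<close> the vertices at cycle
  distance two on both sides are the hub at \<open>M - 2\<close>, which closes a 4-cycle, impossible
  for \<open>k \<ge> 3\<close>.\<close>

lemma chain_no_even_cycle:
  assumes l: "l \<ge> 1" and k: "k \<ge> 3" and len: "length xs = 2 * k" and dist: "distinct xs"
    and adj: "successively (chain_adj l s) (xs @ [hd xs])"
  shows False
proof -
  let ?N = "2 * k"
  define v where "v i = xs ! (i mod ?N)" for i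
  have adjv: "chain_adj l s (v i) (v (Suc i))" for i
  proof -
    have "chain_adj l s (xs ! (i mod ?N)) (xs ! (Suc (i mod ?N) mod ?N))"
      using adj k unfolding successively_closed len by auto
    then show ?thesis by (simp add: v_def mod_Suc_eq)
  qed
  have neq: "v i \<noteq> v (i + d)" if "0 < d" "d < ?N" for i d
  proof
    assume "v i = v (i + d)"
    then have "(i + d) mod ?N = i mod ?N" using dist len k by (auto simp: v_def nth_eq_iff_index_eq)
    then have "?N dvd (i + d) - i" by (subst mod_eq_dvd_iff_nat[symmetric]) auto
    then show False using that by (auto dest: dvd_imp_le)
  qed
  have period: "v (i + ?N) = v i" for i by (simp add: v_def)
  have V: "v i \<in> chain_verts l s" for i using adjv by (auto simp: chain_adj_def)
  have hub: "snd (v i) = 0" if "even (fst (v i))" for i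
    using V[of i] that by (auto simp: chain_verts_def)
  have eqI: "v i = v j" if "fst (v i) = fst (v j)" "even (fst (v i))" for i j
    using hub[of i] hub[of j] that by (simp add: prod_eq_iff)
  have no_wrap: "{fst (v i), fst (v (Suc i))} \<noteq> {0, 2 * l}" for i
  proof
    assume wrap: "{fst (v i), fst (v (Suc i))} = {0, 2 * l}"
    then have ev: "even (fst (v i))" "even (fst (v (Suc i)))" by (auto simp: doubleton_eq_iff)
    \<comment> \<open>The special edge does not recur, so parity alternates from
      \<open>v (Suc i)\<close> on; after \<open>?N - 1\<close> steps, an odd number, the cycle is
      back at \<open>v i\<close> with the wrong parity.\<close>
    have "even (fst (v (Suc (i + t)))) \<longleftrightarrow> even t" if "t < ?N" for t
      using that
    proof (induction t)
      case 0
      then show ?case using ev by simp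
    next
      case (Suc t)
      let ?a = "v (Suc (i + t))" and ?b = "v (Suc (i + Suc t))"
      have "{fst ?a, fst ?b} \<noteq> {0, 2 * l}"
      proof
        assume w: "{fst ?a, fst ?b} = {0, 2 * l}"
        then have "even (fst ?a)" "even (fst ?b)" by (auto simp: doubleton_eq_iff)
        moreover have "fst ?a = fst (v i) \<or> fst ?a = fst (v (Suc i)) \<and> fst ?b = fst (v i)"
          using w wrap l by (auto simp: doubleton_eq_iff)
        ultimately have "?a = v i \<or> ?b = v i \<and> ?a = v (Suc i)"
          using ev eqI by metis
        moreover have "?a \<noteq> v i" using neq[of "Suc t" i] Suc.prems by simp
        moreover have "?a = v (Suc i) \<Longrightarrow> t = 0" using neq[of t "Suc i"] Suc.prems by fastforce
        moreover have "v i \<noteq> v (i + 2)" using k by (intro neq) auto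
        ultimately show False by auto
      qed
      then have "fst ?a = Suc (fst ?b) \<or> fst ?b = Suc (fst ?a)"
        using adjv[of "Suc (i + t)"] by (auto simp: chain_adj_def)
      then show ?case using Suc by auto
    qed
    from this[of "?N - 1"] have "odd (fst (v (Suc (i + (?N - 1)))))" using k by simp
    moreover have "Suc (i + (?N - 1)) = i + ?N" using k by simp
    ultimately show False using period[of i] ev by simp
  qed
  have step: "fst (v i) = Suc (fst (v (Suc i))) \<or> fst (v (Suc i)) = Suc (fst (v i))" for i
    using adjv[of i] no_wrap[of i] by (auto simp: chain_adj_def)
  define M where "M = Max (range (fst \<circ> v))"
  have fin: "finite (range (fst \<circ> v))"
  proof (rule finite_subset)
    show "range (fst \<circ> v) \<subseteq> {..2 * l}"
      using subsetD[OF chain_verts_subset V] by (auto simp: mem_Times_iff)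
  qed simp
  have le: "fst (v i) \<le> M" for i unfolding M_def using fin by (intro Max_ge) auto
  have "M \<in> range (fst \<circ> v)" unfolding M_def using fin by (intro Max_in) auto
  then obtain j where j: "fst (v j) = M" by auto
  \<comment> \<open>The period is added before 2 is subtracted, so that natural subtraction is exact
    and \<open>p + 2\<close> is a top vertex.\<close>
  define p where "p = j + ?N - 2"
  have "p + 2 = j + ?N" using k by (simp add: p_def)
  then have p2: "fst (v (p + 2)) = M" using j period[of j] by simp
  have down: "Suc (fst (v (p + 1))) = M" "Suc (fst (v (p + 3))) = M"
    using step[of "p + 1"] step[of "p + 2"] le[of "p + 1"] le[of "p + 3"] p2
    by (auto simp: numeral_eq_Suc)
  have n2: "v i \<noteq> v (i + 2)" "v i \<noteq> v (i + 4)" for i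
    using neq[of 2 i] neq[of 4 i] k by auto
  show False
  proof (cases "even M")
    case False
    then have "v (p + 1) = v (p + 3)" using down by (intro eqI) auto
    then show False using n2(1)[of "p + 1"] by (simp add: numeral_eq_Suc)
  next
    case True
    have "Suc (fst (v p)) = fst (v (p + 1))"
    proof (rule ccontr)
      assume "\<not> ?thesis"
      then have "fst (v p) = M" using step[of p] down by auto
      then have "v p = v (p + 2)" using p2 True by (intro eqI) auto
      then show False using n2(1) by blast
    qed
    moreover have "Suc (fst (v (p + 4))) = fst (v (p + 3))"
    proof (rule ccontr)
      assume "\<not> ?thesis"
      then have "fst (v (p + 4)) = M" using step[of "p + 3"] down by (auto simp: numeral_eq_Suc)
      then have "v (p + 2) = v (p + 4)" using p2 True by (intro eqI) auto
      then show False using n2(1)[of "p + 2"] by (simp add: numeral_eq_Suc)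
    qed
    ultimately have "M = fst (v p) + 2" "fst (v p) = fst (v (p + 4))" using down by linarith+
    then have "v p = v (p + 4)" using True by (intro eqI) auto
    then show False using n2(2) by blast
  qed
qed

text \<open>Each of the \<open>l\<close> odd levels offers \<open>s\<close> choices;
  \<open>F js\<close> visits the levels from \<open>0\<close> to \<open>2 * l\<close> in
  turn.\<close>

lemma ex_rainbow_lower_ge_3:
  assumes k: "k \<ge> 3" and l: "l \<ge> 1" and n: "(2 * l + 1) * (s + 1) \<le> n"
  shows "s ^ l \<le> (2 * l + 1) ^ (2 * l + 1) * ex_rainbow n (cycle_graph (2 * l + 1)) (cycle_graph (2 * k))"
proof -
  define L where "L = {js. set js \<subseteq> {..<s} \<and> length js = l}"
  define F where "F js = map (\<lambda>a. (a, if even a then 0 else js ! (a div 2))) [0..<2 * l + 1]" for js :: "nat list"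
  have nthF: "F js ! a = (a, if even a then 0 else js ! (a div 2))" if "a \<le> 2 * l" for js a
    unfolding F_def using that by (subst nth_map) (simp_all del: upt_Suc)
  have lenF: "length (F js) = 2 * l + 1" for js by (simp add: F_def)
  have "inj_on F L"
  proof (rule inj_onI, rule nth_equalityI)
    fix js js' i assume js: "js \<in> L" "js' \<in> L" "F js = F js'" and "i < length js"
    then have "i < l" by (simp add: L_def)
    then show "js ! i = js' ! i"
      using arg_cong[OF js(3), of "\<lambda>xs. snd (xs ! (2 * i + 1))"] by (simp add: nthF)
  qed (auto simp: L_def)
  then have "s ^ l = card (F ` L)" by (simp add: card_image L_def card_lists_length_eq)
  also have "\<dots> \<le> (2 * l + 1) ^ (2 * l + 1) * ex_rainbow n (cycle_graph (2 * l + 1)) (cycle_graph (2 * k))"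
  proof (rule ex_rainbow_lower[where adj = "chain_adj l s" and V = "chain_verts l s"])
    show "finite (chain_verts l s)" by (rule finite_subset[OF chain_verts_subset]) auto
    show "card (chain_verts l s) \<le> n" using card_chain_verts n order_trans by blast
    show "chain_adj l s x y \<Longrightarrow> chain_adj l s y x" for x y by (auto simp: chain_adj_def doubleton_eq_iff)
    show "\<not> chain_adj l s x x" for x using l by (auto simp: chain_adj_def)
    show "length xs = 2 * l + 1 \<and> distinct xs \<and> successively (chain_adj l s) (xs @ [hd xs])" if xs: "xs \<in> F ` L" for xs
    proof -
      obtain js where js: "xs = F js" "set js \<subseteq> {..<s}" "length js = l" using xs by (auto simp: L_def)
      have V: "xs ! a \<in> chain_verts l s" if "a \<le> 2 * l" for a
      proof -
        have "js ! (a div 2) < s" if "odd a"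
        proof -
          have "a div 2 < length js" using \<open>a \<le> 2 * l\<close> that js(3) by (auto elim!: oddE)
          then show ?thesis using js(2) nth_mem by blast
        qed
        then show ?thesis using that by (simp add: js(1) nthF chain_verts_def)
      qed
      have fst: "fst (xs ! a) = a" if "a \<le> 2 * l" for a using that by (simp add: js(1) nthF)
      have "chain_adj l s (xs ! a) (xs ! (Suc a mod (2 * l + 1)))" if "a < 2 * l + 1" for a
      proof (cases "a = 2 * l")
        case True
        then show ?thesis using V[of "2 * l"] V[of 0] fst[of "2 * l"] fst[of 0] by (auto simp: chain_adj_def)
      next
        case False
        then have "Suc a mod (2 * l + 1) = Suc a" "Suc a \<le> 2 * l" using that by auto
        then show ?thesis using V[of a] V[of "Suc a"] fst[of a] fst[of "Suc a"] by (simp add: chain_adj_def)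
      qed
      moreover have "distinct xs" by (auto simp: js(1) F_def distinct_map inj_on_def)
      ultimately show ?thesis using lenF js(1) by (simp add: successively_closed)
    qed
  qed (use k l chain_no_even_cycle in \<open>auto simp: chain_adj_def\<close>)
  finally show ?thesis .
qed

subsection \<open>Extremal graphs for k = 2\<close>

lemma bit_closure_two [simp]: "(2 :: bit alg_closure) = 0"
proof -
  have "(2 :: bit alg_closure) = to_ac 2" by (simp only: to_ac_numeral)
  also have "\<dots> = 0" by (simp only: bit_2_eq_0 to_ac_0)
  finally show ?thesis .
qed

lemma bit_closure_double [simp]: "(x :: bit alg_closure) + x = 0"
  by (metis bit_closure_two mult_2 mult_zero_left)

lemma bit_closure_uminus [simp]: "- (x :: bit alg_closure) = x"
  by (rule minus_unique) simp

lemma bit_closure_add_eq_0_iff: "(x :: bit alg_closure) + y = 0 \<longleftrightarrow> x = y"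
  by (metis add_eq_0_iff bit_closure_uminus)

lemma bit_closure_power2_add: "((x :: bit alg_closure) + y)\<^sup>2 = x\<^sup>2 + y\<^sup>2"
proof -
  have "(x + y)\<^sup>2 = x\<^sup>2 + y\<^sup>2 + (x * y + x * y)" by (simp add: power2_eq_square algebra_simps)
  then show ?thesis by simp
qed

lemma bit_closure_power_add: "((x :: bit alg_closure) + y) ^ (2 ^ m) = x ^ (2 ^ m) + y ^ (2 ^ m)"
  by (induction m) (simp_all add: power_mult bit_closure_power2_add mult.commute[of 2])

text \<open>Fixed points of the \<open>m\<close>-th iterate of the Frobenius map: for
  \<open>m > 0\<close> the finite field inside its algebraic closure.\<close>

definition gf2 :: "nat \<Rightarrow> bit alg_closure set" where
  "gf2 m = {x. x ^ (2 ^ m) = x}"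

lemma gf2_closed:
  assumes "x \<in> gf2 m" "y \<in> gf2 m"
  shows "x + y \<in> gf2 m" "x * y \<in> gf2 m" "x / y \<in> gf2 m" "1 \<in> gf2 m"
  using assms by (auto simp: gf2_def bit_closure_power_add power_mult_distrib power_divide)

text \<open>The closure contains a square root \<open>y\<close>. Its image
  \<open>y ^ (2 ^ m)\<close> is a square root of \<open>x\<close> too, and square roots are unique
  in characteristic 2.\<close>

lemma gf2_sqrt:
  assumes "x \<in> gf2 m"
  obtains y where "y \<in> gf2 m" "y * y = x"
proof -
  obtain y where y: "y ^ 2 = x" using nth_root_exists[of 2 x] by auto
  have "(y ^ (2 ^ m)) ^ 2 = (y ^ 2) ^ (2 ^ m)" by (simp add: mult.commute flip: power_mult)
  also have "\<dots> = y ^ 2" using assms y by (simp add: gf2_def)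
  finally have "(y ^ (2 ^ m) + y) ^ 2 = 0" by (simp add: bit_closure_power2_add)
  then have "y ^ (2 ^ m) = y" by (simp add: bit_closure_add_eq_0_iff)
  then show ?thesis using y that by (auto simp: gf2_def power2_eq_square)
qed

text \<open>The derivative of \<open>X ^ (2 ^ m) + X\<close> is the constant 1, so its roots are simple.\<close>

lemma card_gf2:
  assumes "m > 0"
  shows "card (gf2 m) = 2 ^ m"
proof -
  define p :: "bit alg_closure poly" where "p = monom 1 (2 ^ m) + monom 1 1"
  have m1: "(1::nat) < 2 ^ m" using assms by (intro one_less_power) auto
  have deg: "degree p = 2 ^ m"
    unfolding p_def using m1 by (subst degree_add_eq_left) (auto simp: degree_monom_eq)
  then have p0: "p \<noteq> 0" using m1 by auto
  then obtain A where A: "size A = degree p" "p = smult (lead_coeff p) (\<Prod>x\<in>#A. [:-x, 1:])"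
    using alg_closed_imp_factorization by blast
  have roots: "poly p x = 0 \<longleftrightarrow> x \<in> gf2 m" for x
    by (simp add: p_def poly_monom gf2_def bit_closure_add_eq_0_iff)
  have "poly p x = lead_coeff p * (\<Prod>a\<in>#A. a + x)" for x
    by (subst A(2)) (simp add: poly_prod_mset image_mset.compositionality comp_def)
  then have set: "set_mset A = gf2 m"
    using roots p0 by (auto simp: image_iff bit_closure_add_eq_0_iff)
  have char2: "of_nat (2 ^ m) = (0 :: bit alg_closure)"
    using assms by (cases m) (auto simp: mult_2 simp del: of_nat_power)
  have count: "count A x \<le> 1" for x
  proof (rule ccontr)
    assume "\<not> ?thesis"
    then have "{#x, x#} \<subseteq># A" by (auto simp: subseteq_mset_def)
    then obtain B where "A = {#x, x#} + B" by (metis subset_mset.add_diff_inverse)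
    then have "p = [:-x, 1:] * ([:-x, 1:] * smult (lead_coeff p) (\<Prod>x\<in>#B. [:-x, 1:]))"
      using A(2) by (simp add: mult_ac)
    then obtain r where r: "p = [:-x, 1:] * ([:-x, 1:] * r)" by blast
    have "poly (pderiv ([:-x, 1:] * s)) x = 0" if "poly s x = 0" for s
      using that by (simp add: pderiv_mult pderiv_pCons del: mult_pCons_left)
    from this[of "[:-x, 1:] * r"] have "poly (pderiv p) x = 0" using r by simp
    moreover have "pderiv p = 1" using char2 by (simp add: p_def pderiv_add pderiv_monom)
    ultimately show False by simp
  qed
  have "size A = (\<Sum>x\<in>gf2 m. count A x)" using set by (simp add: size_multiset_overloaded_eq)
  also have "\<dots> = (\<Sum>x\<in>gf2 m. 1)"
    using set count by (intro sum.cong refl) (metis One_nat_def count_eq_zero_iff le_Suc_eq le_zero_eq)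
  finally show ?thesis using A(1) deg by simp
qed

lemma finite_gf2: "m > 0 \<Longrightarrow> finite (gf2 m)"
  using card_gf2[of m] by (intro card_ge_0_finite) simp

section \<open>A graph without 4-cycles over a field\<close>

text \<open>Unequal first coordinates exclude loops; in characteristic 2 they say that the product
  is non-zero.\<close>

definition field_adj :: "'a::field set \<Rightarrow> 'a \<times> 'a \<Rightarrow> 'a \<times> 'a \<Rightarrow> bool" where
  "field_adj K u v \<longleftrightarrow> u \<in> K \<times> K \<and> v \<in> K \<times> K \<and> fst u \<noteq> fst v \<and> snd u * snd v = fst u + fst v"

text \<open>Subtracting equations gives \<open>(a2 - c2) * b2 = a1 - c1 = (a2 - c2) * d2\<close>.
  Either \<open>a2 = c2\<close>, whence \<open>a = c\<close>, or \<open>b2 = d2\<close>, whence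
  \<open>b = d\<close>.\<close>

lemma field_adj_no_C4:
  assumes "field_adj K a b" "field_adj K b c" "field_adj K c d" "field_adj K d a"
  shows "a = c \<or> b = d"
proof -
  obtain a1 a2 b1 b2 c1 c2 d1 d2 where [simp]: "a = (a1, a2)" "b = (b1, b2)" "c = (c1, c2)" "d = (d1, d2)"
    by (metis prod.exhaust)
  have e: "a2 * b2 = a1 + b1" "b2 * c2 = b1 + c1" "c2 * d2 = c1 + d1" "d2 * a2 = d1 + a1"
    using assms by (auto simp: field_adj_def)
  have "(a2 - c2) * b2 = a1 - c1" "(a2 - c2) * d2 = a1 - c1" using e by (simp_all add: algebra_simps)
  then have z: "(a2 - c2) * (b2 - d2) = 0" by (simp add: right_diff_distrib)
  show ?thesis
  proof (cases "a2 = c2")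
    case True
    then show ?thesis using \<open>(a2 - c2) * b2 = a1 - c1\<close> by simp
  next
    case False
    then have "b2 = d2" using z by simp
    then show ?thesis using e by (metis \<open>b = (b1, b2)\<close> \<open>d = (d1, d2)\<close> add.commute add_left_cancel mult.commute)
  qed
qed

text \<open>Given distinct first coordinates \<open>us\<close>, going once around the cycle multiplies or divides
  alternately, so an odd cycle closes up iff the square of the initial second coordinate has a
  prescribed value, and squaring is bijective in characteristic 2.\<close>

lemma gf2_odd_cycle:
  assumes us: "length us = 2 * l + 1" "distinct us" "set us \<subseteq> gf2 m" and l: "l \<ge> 1"
  obtains xs where "map fst xs = us" "successively (field_adj (gf2 m)) (xs @ [hd xs])"
    "set xs \<subseteq> gf2 m \<times> gf2 m"
proof -
  let ?K = "gf2 m"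
  define a where "a i = us ! i + us ! (Suc i mod (2 * l + 1))" for i
  have K: "us ! i \<in> ?K" if "i \<le> 2 * l" for i
    using us that by (auto intro!: subsetD[OF us(3)] nth_mem)
  have a: "a i \<in> ?K" "a i \<noteq> 0" "us ! i \<noteq> us ! (Suc i mod (2 * l + 1))" if "i \<le> 2 * l" for i
  proof -
    have "i \<noteq> Suc i mod (2 * l + 1)" using that l by (cases "i = 2 * l") auto
    moreover have lt: "Suc i mod (2 * l + 1) < 2 * l + 1" by simp
    ultimately show ne: "us ! i \<noteq> us ! (Suc i mod (2 * l + 1))"
      using us that by (simp add: nth_eq_iff_index_eq)
    show "a i \<noteq> 0" using ne by (simp add: a_def bit_closure_add_eq_0_iff)
    show "a i \<in> ?K" using K that lt unfolding a_def by (intro gf2_closed K) auto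
  qed
  \<comment> \<open>\<open>g\<close> solves \<open>g i * g (Suc i) = a i\<close> with
    \<open>g 0 = 1\<close>. Alternately multiplying and dividing by \<open>t\<close> preserves these
    products and leaves one free parameter.\<close>
  define g :: "nat \<Rightarrow> bit alg_closure" where "g = rec_nat 1 (\<lambda>i r. a i / r)"
  have g0: "g 0 = 1" and gS: "g (Suc i) = a i / g i" for i by (simp_all add: g_def)
  have g: "g i \<in> ?K \<and> g i \<noteq> 0" if "i \<le> 2 * l" for i
    using that
  proof (induction i)
    case 0
    then show ?case using gf2_closed(4)[OF a(1,1)[of 0]] by (simp add: g0)
  next
    case (Suc i)
    then show ?case using a[of i] by (auto simp: gS intro: gf2_closed)
  qed
  \<comment> \<open>The closing edge joins two even indices and asks for
    \<open>g (2 * l) * t * t = a (2 * l)\<close>.\<close>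
  obtain t where t: "t \<in> ?K" "t * t = a (2 * l) / g (2 * l)"
    using gf2_sqrt[OF gf2_closed(3)[OF a(1) conjunct1[OF g]]] by blast
  have t0: "t \<noteq> 0" using t(2) a(2)[of "2 * l"] g[of "2 * l"] by auto
  define y where "y i = (if even i then g i * t else g i / t)" for i
  have yK: "y i \<in> ?K" if "i \<le> 2 * l" for i
    using g[OF that] t by (auto simp: y_def intro: gf2_closed)
  have yy: "y i * y (Suc i mod (2 * l + 1)) = a i" if "i \<le> 2 * l" for i
  proof (cases "i = 2 * l")
    case True
    then show ?thesis using t(2) g[of "2 * l"] by (simp add: y_def g0 field_simps)
  next
    case False
    then show ?thesis using that t0 g[OF that] by (simp add: y_def gS)
  qed
  define xs where "xs = map (\<lambda>i. (us ! i, y i)) [0..<2 * l + 1]"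
  have len: "length xs = 2 * l + 1" by (simp add: xs_def)
  have nth: "xs ! i = (us ! i, y i)" if "i < 2 * l + 1" for i
    unfolding xs_def using that by (subst nth_map) (simp_all del: upt_Suc)
  show ?thesis
  proof (rule that)
    show "map fst xs = us" using us(1) by (intro nth_equalityI) (auto simp: len nth)
    show "set xs \<subseteq> ?K \<times> ?K" using K yK by (auto simp: in_set_conv_nth len nth)
    have "field_adj ?K (xs ! i) (xs ! (Suc i mod (2 * l + 1)))" if "i < 2 * l + 1" for i
    proof -
      have "Suc i mod (2 * l + 1) < 2 * l + 1" by simp
      then show ?thesis
        using that K[of i] yK[of i] K[of "Suc i mod (2 * l + 1)"] yK[of "Suc i mod (2 * l + 1)"]
          a(3)[of i] yy[of i] nth[of i] nth[of "Suc i mod (2 * l + 1)"]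
        by (auto simp: field_adj_def a_def)
    qed
    then show "successively (field_adj ?K) (xs @ [hd xs])" by (simp add: successively_closed len)
  qed
qed

text \<open>Each list of \<open>2 * l + 1\<close> distinct first coordinates yields a cycle, and
  every factor of the falling factorial counting them is at least \<open>2 ^ m - 2 * l\<close>. For
  a smaller field the truncated difference is 0.\<close>

lemma ex_rainbow_lower_2:
  assumes l: "l \<ge> 1" and m: "m > 0" and n: "4 ^ m \<le> n"
  shows "(2 ^ m - 2 * l) ^ (2 * l + 1) \<le>
    (2 * l + 1) ^ (2 * l + 1) * ex_rainbow n (cycle_graph (2 * l + 1)) (cycle_graph (2 * 2))"
proof (cases "2 * l + 1 \<le> (2::nat) ^ m")
  case False
  then show ?thesis by simp
next
  case True
  let ?K = "gf2 m"
  let ?U = "{us. length us = 2 * l + 1 \<and> distinct us \<and> set us \<subseteq> ?K}"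
  define Z where "Z = {xs. set xs \<subseteq> ?K \<times> ?K \<and> length xs = 2 * l + 1 \<and> distinct xs \<and>
    successively (field_adj ?K) (xs @ [hd xs])}"
  have "finite Z"
    by (rule finite_subset[OF _ finite_lists_length_eq[of "?K \<times> ?K" "2 * l + 1"]])
      (use finite_gf2[OF m] in \<open>auto simp: Z_def\<close>)
  have "(2 ^ m - 2 * l) ^ (2 * l + 1) = (\<Prod>i\<in>{2 ^ m - (2 * l + 1) + 1..2 ^ m}. 2 ^ m - 2 * l)"
    using True by simp
  also have "\<dots> \<le> \<Prod>{2 ^ m - (2 * l + 1) + 1..2 ^ m}" by (intro prod_mono) auto
  also have "\<dots> = card ?U"
    using card_lists_distinct_length_eq[OF finite_gf2[OF m], of "2 * l + 1"] card_gf2[OF m] True by simp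
  also have "\<dots> \<le> card (map fst ` Z)"
  proof (intro card_mono finite_imageI \<open>finite Z\<close> subsetI)
    fix us assume us: "us \<in> ?U"
    then obtain xs where xs: "map fst xs = us" "successively (field_adj ?K) (xs @ [hd xs])" "set xs \<subseteq> ?K \<times> ?K"
      using gf2_odd_cycle[of us l m] l by auto
    then have "length xs = 2 * l + 1" "distinct xs" using us by (auto dest: distinct_map[THEN iffD1])
    then show "us \<in> map fst ` Z" using xs by (auto simp: Z_def)
  qed
  also have "\<dots> \<le> card Z" by (rule card_image_le[OF \<open>finite Z\<close>])
  also have "\<dots> \<le> (2 * l + 1) ^ (2 * l + 1) * ex_rainbow n (cycle_graph (2 * l + 1)) (cycle_graph (2 * 2))"
  proof (rule ex_rainbow_lower[where adj = "field_adj ?K" and V = "?K \<times> ?K"])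
    show "finite (?K \<times> ?K)" using finite_gf2[OF m] by simp
    show "card (?K \<times> ?K) \<le> n"
      using n card_gf2[OF m] by (simp add: card_cartesian_product flip: power_mult_distrib)
    show False if xs: "length xs = 2 * 2" "distinct xs" "successively (field_adj ?K) (xs @ [hd xs])" for xs
    proof -
      obtain a b c d where "xs = [a, b, c, d]"
        using xs(1) by (auto simp: length_Suc_conv numeral_eq_Suc)
      then show False using xs(2,3) field_adj_no_C4[of ?K a b c d] by auto
    qed
  qed (use l in \<open>auto simp: field_adj_def Z_def mult.commute add.commute\<close>)
  finally show ?thesis .
qed

subsection \<open>Orders of magnitude\<close>

lemma bigtheta_sandwich:
  fixes f g :: "nat \<Rightarrow> real"
  assumes "c > 0" "eventually (\<lambda>n. 0 \<le> g n \<and> c * g n \<le> f n \<and> f n \<le> C * g n) sequentially"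
  shows "f \<in> \<Theta>(g)"
proof (rule bigthetaI)
  have "eventually (\<lambda>n. norm (f n) \<le> C * norm (g n) \<and> norm (f n) \<ge> c * norm (g n)) sequentially"
    using assms(2)
  proof eventually_elim
    case (elim n)
    then have "0 \<le> f n" using assms(1) by (meson mult_nonneg_nonneg less_imp_le order_trans)
    then show ?case using elim by simp
  qed
  then show "f \<in> O(g)" "f \<in> \<Omega>(g)"
    using assms(1) by (auto intro!: bigoI landau_omega.bigI simp: eventually_conj_iff)
qed

lemma ex_rainbow_bigtheta_ge_3:
  assumes "k \<ge> 3" "l \<ge> 2"
  shows "(\<lambda>n. real (ex_rainbow n (cycle_graph (2 * l + 1)) (cycle_graph (2 * k)))) \<in> \<Theta>(\<lambda>n. real n ^ l)"
proof -
  let ?ex = "\<lambda>n. ex_rainbow n (cycle_graph (2 * l + 1)) (cycle_graph (2 * k))"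
  let ?m = "2 * l + 1"
  obtain C where C: "\<And>n. ?ex n \<le> C * n ^ l" using ex_rainbow_upper_ge_3[OF assms] by blast
  \<comment> \<open>\<open>?m ^ ?m\<close> comes from \<open>ex_rainbow_lower_ge_3\<close>, and
    \<open>2 * ?m\<close> from comparing \<open>n\<close> with \<open>s\<close>.\<close>
  define c where "c = 1 / (real (?m ^ ?m) * real (2 * ?m) ^ l)"
  show ?thesis
  proof (rule bigtheta_sandwich)
    have "0 < real (?m ^ ?m)" "0 < real (2 * ?m)" unfolding of_nat_0_less_iff by simp_all
    then show "c > 0" by (simp only: c_def zero_less_divide_1_iff mult_pos_pos zero_less_power)
    show "eventually (\<lambda>n. 0 \<le> real n ^ l \<and> c * real n ^ l \<le> real (?ex n) \<and> real (?ex n) \<le> real C * real n ^ l) sequentially"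
      using eventually_ge_at_top[of "4 * ?m"]
    proof eventually_elim
      case (elim n)
      \<comment> \<open>The largest \<open>s\<close> that the vertex count admits. As the quotient
        is at least 4, adding 1 to it gives at most \<open>2 * s\<close>, so
        \<open>n \<le> 2 * ?m * s\<close>.\<close>
      define s where "s = n div ?m - 1"
      have n: "n < ?m * (n div ?m + 1)" by (metis Suc_eq_plus1 dividend_less_times_div mult.commute mult_Suc zero_less_Suc add.commute)
      have d: "4 \<le> n div ?m" using elim by (subst less_eq_div_iff_mult_less_eq) auto
      have "s + 1 = n div ?m" using d by (simp add: s_def)
      then have "?m * (s + 1) \<le> n" by (simp only: times_div_less_eq_dividend)
      then have low: "s ^ l \<le> ?m ^ ?m * ?ex n"
        using ex_rainbow_lower_ge_3[of k l s n] assms by auto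
      have "n div ?m + 1 \<le> 2 * s" using d by (simp add: s_def)
      then have "?m * (n div ?m + 1) \<le> ?m * (2 * s)" by (rule mult_left_mono) simp
      then have "n \<le> (2 * ?m) * s" using n by (simp add: mult_ac)
      then have "n ^ l \<le> ((2 * ?m) * s) ^ l" by (intro power_mono) auto
      also have "\<dots> \<le> (2 * ?m) ^ l * (?m ^ ?m * ?ex n)"
        unfolding power_mult_distrib[of "2 * ?m"] by (intro mult_left_mono low) simp
      finally have "real (n ^ l) \<le> real ((2 * ?m) ^ l * (?m ^ ?m * ?ex n))" by (rule of_nat_mono)
      then have "real n ^ l \<le> (real (?m ^ ?m) * real (2 * ?m) ^ l) * real (?ex n)"
        by (simp only: of_nat_mult of_nat_power mult_ac)
      then have "c * real n ^ l \<le> real (?ex n)"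
        unfolding c_def by (simp add: pos_divide_le_eq mult_ac del: of_nat_power of_nat_mult of_nat_add of_nat_Suc)
      moreover have "real (?ex n) \<le> real C * real n ^ l"
        using of_nat_mono[OF C[of n], where 'a = real] by simp
      ultimately show ?case by simp
    qed
  qed
qed

lemma ex_rainbow_bigtheta_2:
  assumes "l \<ge> 2"
  shows "(\<lambda>n. real (ex_rainbow n (cycle_graph (2 * l + 1)) (cycle_graph (2 * 2))))
    \<in> \<Theta>(\<lambda>n. real n powr (real l + 1 / 2))"
proof -
  let ?ex = "\<lambda>n. ex_rainbow n (cycle_graph (2 * l + 1)) (cycle_graph (2 * 2))"
  let ?m = "2 * l + 1"
  obtain C where C: "\<And>n. (?ex n)\<^sup>2 \<le> C * n ^ ?m" using ex_rainbow_upper_ge_2[OF order_refl assms] by blast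
  define M where "M = real (?m ^ ?m)"
  have M: "M > 0" unfolding M_def of_nat_0_less_iff by simp
  define c where "c = 1 / (M * 4 ^ ?m)"
  show ?thesis
  proof (rule bigtheta_sandwich)
    show "c > 0" using M by (simp add: c_def)
    show "eventually (\<lambda>n. 0 \<le> real n powr (real l + 1 / 2) \<and> c * real n powr (real l + 1 / 2) \<le> real (?ex n) \<and>
        real (?ex n) \<le> sqrt (real C) * real n powr (real l + 1 / 2)) sequentially"
      using eventually_ge_at_top[of "64 * l\<^sup>2"] eventually_ge_at_top[of 4]
    proof eventually_elim
      case (elim n)
      have pw: "real n powr (real l + 1 / 2) = sqrt (real n) ^ ?m"
      proof -
        have "real n powr (real l + 1 / 2) = real n ^ l * sqrt (real n)"
          using elim by (simp add: powr_add powr_realpow powr_half_sqrt)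
        then show ?thesis by (simp add: power_add power_mult)
      qed
      have "(real (?ex n))\<^sup>2 \<le> real C * real n ^ ?m"
        using of_nat_mono[OF C[of n], where 'a = real] by simp
      then have "real (?ex n) \<le> sqrt (real C * real n ^ ?m)" by (rule real_le_rsqrt)
      then have up: "real (?ex n) \<le> sqrt (real C) * sqrt (real n) ^ ?m"
        by (simp add: real_sqrt_mult real_sqrt_power)
      \<comment> \<open>The largest power of 4 up to \<open>n\<close>: the field has
        \<open>2 ^ r\<close> elements, more than half of \<open>sqrt n\<close>.\<close>
      obtain r where r: "4 ^ r \<le> n" "n < 4 ^ (r + 1)"
        using ex_power_ivl1[of 4 n] elim by auto
      have "r > 0" using r(2) elim by (cases r) auto
      define q where "q = real (2 ^ r)"
      have "real n < real (4 ^ (r + 1))" using r(2) by (rule of_nat_less_iff[THEN iffD2])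
      also have "\<dots> = (2 * q)\<^sup>2" by (simp add: q_def power2_eq_square flip: power_mult_distrib)
      finally have sq: "sqrt (real n) < 2 * q" by (intro real_less_lsqrt) (auto simp: q_def)
      have "real (64 * l\<^sup>2) \<le> real n" using elim by (intro of_nat_mono)
      then have "(8 * real l)\<^sup>2 \<le> real n" by (simp add: power_mult_distrib)
      then have "8 * real l \<le> sqrt (real n)" by (rule real_le_rsqrt)
      \<comment> \<open>Hence subtracting \<open>2 * l\<close> costs at most half of
        \<open>q\<close>, leaving at least \<open>sqrt n / 4\<close>; this is the 4 in
        \<open>c\<close>.\<close>
      then have ql: "4 * real l \<le> q" using sq by linarith
      then have "real (2 * l) \<le> real (2 ^ r)" by (simp add: q_def)
      then have "2 * l \<le> 2 ^ r" by (simp only: of_nat_le_iff)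
      then have "real (2 ^ r - 2 * l) = q - 2 * real l" by (simp add: q_def of_nat_diff)
      then have "sqrt (real n) / 4 \<le> real (2 ^ r - 2 * l)" using sq ql by linarith
      then have "(sqrt (real n) / 4) ^ ?m \<le> real (2 ^ r - 2 * l) ^ ?m" by (intro power_mono) auto
      also have "\<dots> = real ((2 ^ r - 2 * l) ^ ?m)" by (rule of_nat_power[symmetric])
      also have "\<dots> \<le> real (?m ^ ?m * ?ex n)"
        using assms \<open>r > 0\<close> r(1) by (intro of_nat_mono ex_rainbow_lower_2) auto
      also have "\<dots> = M * real (?ex n)" by (simp only: M_def of_nat_mult)
      finally have "sqrt (real n) ^ ?m \<le> M * 4 ^ ?m * real (?ex n)"
        unfolding power_divide by (subst (asm) pos_divide_le_eq) (simp_all only: mult_ac, simp)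
      then have "c * sqrt (real n) ^ ?m \<le> real (?ex n)"
        unfolding c_def using M by (simp add: pos_divide_le_eq mult_ac del: power_Suc)
      then show ?case using up unfolding pw by simp
    qed
  qed
qed

theorem theorem2p3:
  fixes k l :: nat
  assumes "k \<ge> 2" and "l \<ge> 2"
  shows "(k \<ge> 3 \<longrightarrow>
            (\<lambda>n. real (ex_rainbow n (cycle_graph (2 * l + 1)) (cycle_graph (2 * k))))
              \<in> \<Theta>(\<lambda>n. real n ^ l))
       \<and> (k = 2 \<longrightarrow>
            (\<lambda>n. real (ex_rainbow n (cycle_graph (2 * l + 1)) (cycle_graph (2 * k))))
              \<in> \<Theta>(\<lambda>n. real n powr (real l + 1 / 2)))"
  using ex_rainbow_bigtheta_ge_3[OF _ assms(2)] ex_rainbow_bigtheta_2[OF assms(2)] by blast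

end
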